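(* Let $\Phi\in\overline{\varPhi}_Y$ and $\varphi\in\mathcal{G}^{\rm dec}$. Then the Hardy-Littlewood maximal operator $M$ is bounded from $L^{(\Phi,\varphi)}(\mathbb{R}^n)$ to $\mathrm{w}L^{(\Phi,\varphi)}(\mathbb{R}^n)$. Moreover, if $\Phi\in\overline\nabla_2$, then $M$ is bounded from $L^{(\Phi,\varphi)}(\mathbb{R}^n)$ to itself and from $\mathrm{w}L^{(\Phi,\varphi)}(\mathbb{R}^n)$ to itself.
   Context: $|G|$ is the Lebesgue measure of $G\subset\mathbb{R}^n$; $B(a,r)$ is the open ball with center $a$ and radius $r$; $m(G,f,t)=|\{x\in G:|f(x)|>t\}|$. $M$ is the Hardy-Littlewood maximal operator, $Mf(x)=\sup_{B\ni x}\frac1{|B|}\int_B|f(y)|\,dy$, supremum over all balls $B$ containing $x$. An operator $T$ is bounded from $X$ to $Y$ if there is a constant $C>0$ with $\|Tf\|_Y\le C\|f\|_X$ for all $f\in X$. "Increasing" means nondecreasing. For an increasing $\Phi:[0,\infty]\to[0,\infty]$ let $a(\Phi)=\sup\{t\ge0:\Phi(t)=0\}$ and $b(\Phi)=\inf\{t\ge0:\Phi(t)=\infty\}$, with $\sup\emptyset=0$, $\inf\emptyset=\infty$. $\overline{\varPhi}$ is the set of all increasing $\Phi:[0,\infty]\to[0,\infty]$ such that: $0\le a(\Phi)<\infty$ and $0<b(\Phi)\le\infty$; $\lim_{t\to+0}\Phi(t)=\Phi(0)=0$; $\Phi$ is left continuous on $[0,b(\Phi))$; if $b(\Phi)=\infty$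 then $\lim_{t\to\infty}\Phi(t)=\Phi(\infty)=\infty$; if $b(\Phi)<\infty$ then $\lim_{t\to b(\Phi)-0}\Phi(t)=\Phi(b(\Phi))$ $(\le\infty)$. $\Phi\in\overline{\varPhi}$ is a Young function if it is convex on $[0,b(\Phi))$; $\varPhi_Y$ is the set of Young functions. $\Phi\approx\Psi$ means there is $C>0$ with $\Phi(C^{-1}t)\le\Psi(t)\le\Phi(Ct)$ for all $t\in[0,\infty]$. $\overline{\varPhi}_Y$ is the set of all $\Phi\in\overline{\varPhi}$ such that $\Phi\approx\Psi$ for some $\Psi\in\varPhi_Y$. $\overline\nabla_2$ is the set of all $\Phi\in\overline{\varPhi}$ for which there is $k>1$ with $\Phi(t)\le\frac1{2k}\Phi(kt)$ for all $t>0$ (one has $\overline\nabla_2\subset\overline{\varPhi}_Y$). $\mathcal{G}^{\rm dec}$ is the set of all $\varphi:(0,\infty)\to(0,\infty)$ for which there is $C>0$ such that $C\varphi(r)\ge\varphi(s)$ and $\varphi(r)r^n\le C\varphi(s)s^n$ whenever $0<r<s<\infty$. For $\Phi\in\overline{\varPhi}_Y$, $\varphi:(0,\infty)\to(0,\infty)$ and $B=B(a,r)$, let $$\|f\|_{\Phi,\varphi,B}=\inf\Big\{\lambda>0:\frac1{\varphi(r)|B|}\int_B\Phi\Big(\frac{|f(x)|}\lambda\Big)dx\le1\Big\},\quad \|f\|_{\Phi,\varphi,B,\mathrm{weak}}=\inf\Big\{\lambda>0:\sup_{t\in(0,\infty)}\frac{\Phi(t)\,m(B,f/\lambda,t)}{|B|\varphi(r)}\le1\Big\}$$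 (with $0\cdot\infty=0$). $L^{(\Phi,\varphi)}(\mathbb{R}^n)$ and $\mathrm{w}L^{(\Phi,\varphi)}(\mathbb{R}^n)$ are the sets of measurable $f$ on $\mathbb{R}^n$ with, respectively, $\|f\|_{L^{(\Phi,\varphi)}}=\sup_B\|f\|_{\Phi,\varphi,B}<\infty$ and $\|f\|_{\mathrm{w}L^{(\Phi,\varphi)}}=\sup_B\|f\|_{\Phi,\varphi,B,\mathrm{weak}}<\infty$, suprema over all balls $B$ in $\mathbb{R}^n$. *)

theory Defs
  imports "HOL-Analysis.Analysis"
begin

definition a_of :: "(ennreal \<Rightarrow> ennreal) \<Rightarrow> ennreal" where
  "a_of \<Phi> = Sup {t. \<Phi> t = 0}"

definition b_of :: "(ennreal \<Rightarrow> ennreal) \<Rightarrow> ennreal" where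
  "b_of \<Phi> = Inf {t. \<Phi> t = \<infinity>}"

definition Phi_bar :: "(ennreal \<Rightarrow> ennreal) set" where
  "Phi_bar = {\<Phi>. mono \<Phi> \<and>
     a_of \<Phi> < \<infinity> \<and> 0 < b_of \<Phi> \<and>
     \<Phi> 0 = 0 \<and> (\<Phi> \<longlongrightarrow> \<Phi> 0) (at_right 0) \<and>
     (\<forall>t < b_of \<Phi>. (\<Phi> \<longlongrightarrow> \<Phi> t) (at_left t)) \<and>
     (b_of \<Phi> = \<infinity> \<longrightarrow> \<Phi> \<infinity> = \<infinity> \<and> (\<Phi> \<longlongrightarrow> \<Phi> \<infinity>) (at_left \<infinity>)) \<and>
     (b_of \<Phi> < \<infinity> \<longrightarrow> (\<Phi> \<longlongrightarrow> \<Phi> (b_of \<Phi>)) (at_left (b_of \<Phi>)))}"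

(* \<Phi> is finite on [0, b(\<Phi>)), so passing to real values with enn2real loses nothing there. *)
definition Phi_Y :: "(ennreal \<Rightarrow> ennreal) set" where
  "Phi_Y = {\<Phi> \<in> Phi_bar.
     convex_on {t::real. 0 \<le> t \<and> ennreal t < b_of \<Phi>} (\<lambda>t. enn2real (\<Phi> (ennreal t)))}"

definition Phi_equiv :: "(ennreal \<Rightarrow> ennreal) \<Rightarrow> (ennreal \<Rightarrow> ennreal) \<Rightarrow> bool" where
  "Phi_equiv \<Phi> \<Psi> \<longleftrightarrow>
     (\<exists>C::real. C > 0 \<and> (\<forall>t. \<Phi> (ennreal (inverse C) * t) \<le> \<Psi> t \<and> \<Psi> t \<le> \<Phi> (ennreal C * t)))"

definition Phi_bar_Y :: "(ennreal \<Rightarrow> ennreal) set" where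
  "Phi_bar_Y = {\<Phi> \<in> Phi_bar. \<exists>\<Psi> \<in> Phi_Y. Phi_equiv \<Phi> \<Psi>}"

definition nabla2_bar :: "(ennreal \<Rightarrow> ennreal) set" where
  "nabla2_bar = {\<Phi> \<in> Phi_bar.
     \<exists>k::real. k > 1 \<and> (\<forall>t > 0. \<Phi> t \<le> ennreal (1 / (2 * k)) * \<Phi> (ennreal k * t))}"

(* Functions (0,\<infinity>) \<rightarrow> (0,\<infinity>) are represented by total functions on the reals whose
   values at nonpositive arguments are irrelevant. The argument n is the dimension. *)
definition G_dec :: "nat \<Rightarrow> (real \<Rightarrow> real) set" where
  "G_dec n = {\<phi>. (\<forall>r > 0. \<phi> r > 0) \<and>
     (\<exists>C > 0. \<forall>r s. 0 < r \<and> r < s \<longrightarrow>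
        C * \<phi> r \<ge> \<phi> s \<and> \<phi> r * r ^ n \<le> C * (\<phi> s * s ^ n))}"

(* Functions take values in [-\<infinity>,\<infinity>], since the maximal function of f may be infinite at
   some points. Both spaces below contain only functions that are finite almost everywhere,
   because \<Phi>(t) tends to \<infinity> as t tends to \<infinity>. *)
definition eabs :: "ereal \<Rightarrow> ennreal" where
  "eabs y = e2ennreal \<bar>y\<bar>"

definition distr_fun :: "'a::euclidean_space set \<Rightarrow> ('a \<Rightarrow> ereal) \<Rightarrow> ennreal \<Rightarrow> ennreal" where
  "distr_fun G f t = emeasure lebesgue {x \<in> G. eabs (f x) > t}"

definition ball_norm ::
  "(ennreal \<Rightarrow> ennreal) \<Rightarrow> (real \<Rightarrow> real) \<Rightarrow> 'a::euclidean_space \<Rightarrow> real \<Rightarrow> ('a \<Rightarrow> ereal) \<Rightarrow> ennreal"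
where
  "ball_norm \<Phi> \<phi> a r f = Inf {ennreal \<mu> | \<mu>. \<mu> > 0 \<and>
     (\<integral>\<^sup>+x\<in>ball a r. \<Phi> (eabs (f x) / ennreal \<mu>) \<partial>lebesgue)
        / (ennreal (\<phi> r) * emeasure lebesgue (ball a r)) \<le> 1}"

definition ball_norm_weak ::
  "(ennreal \<Rightarrow> ennreal) \<Rightarrow> (real \<Rightarrow> real) \<Rightarrow> 'a::euclidean_space \<Rightarrow> real \<Rightarrow> ('a \<Rightarrow> ereal) \<Rightarrow> ennreal"
where
  "ball_norm_weak \<Phi> \<phi> a r f = Inf {ennreal \<mu> | \<mu>. \<mu> > 0 \<and>
     (SUP t\<in>{0<..<\<infinity>}. \<Phi> t * distr_fun (ball a r) (\<lambda>x. f x / ereal \<mu>) t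
        / (emeasure lebesgue (ball a r) * ennreal (\<phi> r))) \<le> 1}"

definition OM_norm ::
  "(ennreal \<Rightarrow> ennreal) \<Rightarrow> (real \<Rightarrow> real) \<Rightarrow> ('a::euclidean_space \<Rightarrow> ereal) \<Rightarrow> ennreal" where
  "OM_norm \<Phi> \<phi> f = (SUP (a, r)\<in>UNIV \<times> {0<..}. ball_norm \<Phi> \<phi> a r f)"

definition wOM_norm ::
  "(ennreal \<Rightarrow> ennreal) \<Rightarrow> (real \<Rightarrow> real) \<Rightarrow> ('a::euclidean_space \<Rightarrow> ereal) \<Rightarrow> ennreal" where
  "wOM_norm \<Phi> \<phi> f = (SUP (a, r)\<in>UNIV \<times> {0<..}. ball_norm_weak \<Phi> \<phi> a r f)"

definition OM_space ::
  "(ennreal \<Rightarrow> ennreal) \<Rightarrow> (real \<Rightarrow> real) \<Rightarrow> ('a::euclidean_space \<Rightarrow> ereal) set" where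
  "OM_space \<Phi> \<phi> = {f \<in> borel_measurable lebesgue. OM_norm \<Phi> \<phi> f < \<infinity>}"

definition wOM_space ::
  "(ennreal \<Rightarrow> ennreal) \<Rightarrow> (real \<Rightarrow> real) \<Rightarrow> ('a::euclidean_space \<Rightarrow> ereal) set" where
  "wOM_space \<Phi> \<phi> = {f \<in> borel_measurable lebesgue. wOM_norm \<Phi> \<phi> f < \<infinity>}"

definition HL_maximal :: "('a::euclidean_space \<Rightarrow> ereal) \<Rightarrow> 'a \<Rightarrow> ereal" where
  "HL_maximal f x = enn2ereal
     (SUP (a, r)\<in>{(a, r). 0 < r \<and> x \<in> ball a r}.
        (\<integral>\<^sup>+y\<in>ball a r. eabs (f y) \<partial>lebesgue) / emeasure lebesgue (ball a r))"

definition bounded_operator ::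
  "('f \<Rightarrow> 'g) \<Rightarrow> 'f set \<Rightarrow> ('f \<Rightarrow> ennreal) \<Rightarrow> 'g set \<Rightarrow> ('g \<Rightarrow> ennreal) \<Rightarrow> bool" where
  "bounded_operator T X normX Y normY \<longleftrightarrow>
     (\<exists>C::real. C > 0 \<and> (\<forall>f\<in>X. T f \<in> Y \<and> normY (T f) \<le> ennreal C * normX f))"

end

(* A ball that meets B(a,r) has radius at most r/2, and then lies in B(a,2r), or has radius s > r/2,
   and then phi(s) <= K phi(r). The averages over balls of the second kind are controlled directly by
   the modular inequality on the ball itself. For those of the first kind, Vitali's covering lemma bounds the
   measure of the set where they exceed 2 tau by a multiple of 1/tau times the integral of g over
   {g > tau} in B(a,2r). Equivalence to a Young function enters only as
   Phi(theta s / A) <= theta Phi(s) for 0 < theta <= 1, which gives Phi(t) g <= A t Phi(g) where g > A t.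
   Under the nabla-2 condition Phi(k^(-i) t) <= (2k)^(-i) Phi(t), so decomposing along the levels k^j
   produces geometric series: summing over the levels of Mg gives the strong estimate, and summing
   over the levels of g gives the weak-to-weak one. *)

theory Submission
  imports Defs
begin

subsection \<open>Covering by balls\<close>

text \<open>As \<open>\<Phi>\<close> may vanish on an interval or jump to infinity, it has no
  inverse to work with; the estimates bound products of a value of \<open>\<Phi>\<close> with a
  measure or an integral. The pair (c, D) in \<open>tail_bound\<close> is the common interface: the
  strong hypothesis yields (A, A), the weak one under nabla-2 yields (1, 2k), and one argument then
  gives both weak estimates. The function is not split into parts inside and outside a ball. A large
  ball with average above 2cT forces \<open>\<Phi>\<close> at T to be at most a multiple of
  \<open>\<phi> r\<close>, a bound that no longer involves the point, so only the small balls
  require a measure estimate. Their radius bound r/2 serves twice: it keeps them inside the doubled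
  ball, and it gives Vitali's lemma the bounded radii that it requires. Truncating g at half of the
  level is essential for the strong estimate: under nabla-2 the weighted values of
  \<open>\<Phi>\<close> grow geometrically with the level, and only the truncation cuts off the high
  levels.\<close>

lemma emeasure_ball_scale:
  fixes a b :: "'a::euclidean_space"
  assumes "r \<ge> 0" "m \<ge> 0"
  shows "emeasure lebesgue (ball a (m * r)) = ennreal (m ^ DIM('a)) * emeasure lebesgue (ball b r)"
  using assms by (simp add: emeasure_ball power_mult_distrib ennreal_mult'[symmetric] mult_ac)

lemma emeasure_ball_pos_finite:
  fixes a :: "'a::euclidean_space"
  assumes "r > 0"
  shows "emeasure lebesgue (ball a r) \<noteq> 0" "emeasure lebesgue (ball a r) \<noteq> top"
  using assms less_imp_neq[OF unit_ball_vol_pos[of "real DIM('a)"]] by (simp_all add: emeasure_ball)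

lemma ball_lebesgue [measurable]: "ball a r \<in> sets lebesgue"
  by (simp add: fmeasurableD)

text \<open>A countable disjoint subfamily has fivefold dilates that cover the whole union, which
  costs the factor 5^n; disjointness then merges the integrals over its members into one integral
  over \<open>G\<close>. The selection relies on the uniform bound \<open>R\<close> on the
  radii.\<close>

lemma vitali_weak_bound:
  fixes a :: "'i \<Rightarrow> 'a::euclidean_space" and h :: "'a \<Rightarrow> ennreal"
  assumes h [measurable]: "h \<in> borel_measurable lebesgue"
    and r: "\<And>i. i \<in> K \<Longrightarrow> 0 < r i \<and> r i \<le> R"
    and avg: "\<And>i. i \<in> K \<Longrightarrow>
      \<tau> * emeasure lebesgue (ball (a i) (r i)) \<le> (\<integral>\<^sup>+y\<in>ball (a i) (r i). h y \<partial>lebesgue)"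
    and G: "\<And>i. i \<in> K \<Longrightarrow> ball (a i) (r i) \<subseteq> G"
  shows "\<tau> * emeasure lebesgue (\<Union>i\<in>K. ball (a i) (r i))
    \<le> ennreal (5 ^ DIM('a)) * (\<integral>\<^sup>+y\<in>G. h y \<partial>lebesgue)"
proof -
  obtain C where C: "countable C" "C \<subseteq> K"
    and disj: "pairwise (\<lambda>i j. disjnt (ball (a i) (r i)) (ball (a j) (r j))) C"
    and cov: "(\<Union>i\<in>K. ball (a i) (r i)) \<subseteq> (\<Union>i\<in>C. ball (a i) (5 * r i))"
    by (rule Vitali_covering_lemma_balls[OF order_refl r])
  have U: "(\<Union>i\<in>C. ball (a i) (5 * r i)) \<in> sets lebesgue"
    by (intro sets_completionI_sets) (simp add: borel_open open_UN)
  have "emeasure lebesgue (\<Union>i\<in>K. ball (a i) (r i)) \<le> emeasure lebesgue (\<Union>i\<in>C. ball (a i) (5 * r i))"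
    using cov by (rule emeasure_mono) (rule U)
  also have "\<dots> = (\<integral>\<^sup>+x. indicator (\<Union>i\<in>C. ball (a i) (5 * r i)) x \<partial>lebesgue)"
    by (rule nn_integral_indicator[OF U, symmetric])
  \<comment> \<open>Sums over the selected balls are written as integrals over
    \<open>count_space C\<close>, so that Tonelli applies for an arbitrary index type; it relies on
    \<open>C\<close> being countable.\<close>
  also have "\<dots> \<le> (\<integral>\<^sup>+x. (\<integral>\<^sup>+i. indicator (ball (a i) (5 * r i)) x \<partial>count_space C) \<partial>lebesgue)"
  proof (rule nn_integral_mono)
    fix x
    show "indicator (\<Union>i\<in>C. ball (a i) (5 * r i)) x
      \<le> (\<integral>\<^sup>+i. indicator (ball (a i) (5 * r i)) x \<partial>count_space C :: ennreal)"
    proof (cases "x \<in> (\<Union>i\<in>C. ball (a i) (5 * r i))")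
      case True
      then obtain i where "i \<in> C" "x \<in> ball (a i) (5 * r i)" by blast
      then show ?thesis
        using nn_integral_ge_point[of i C "\<lambda>i. indicator (ball (a i) (5 * r i)) x"] True by simp
    qed simp
  qed
  also have "\<dots> = (\<integral>\<^sup>+i. (\<integral>\<^sup>+x. indicator (ball (a i) (5 * r i)) x \<partial>lebesgue) \<partial>count_space C)"
    by (rule nn_integral_count_space_nn_integral[OF C(1)]) auto
  also have "\<dots> = (\<integral>\<^sup>+i. ennreal (5 ^ DIM('a)) * emeasure lebesgue (ball (a i) (r i)) \<partial>count_space C)"
  proof (rule nn_integral_cong)
    fix i assume "i \<in> space (count_space C)"
    then have "r i \<ge> 0" using C(2) r by fastforce
    then show "(\<integral>\<^sup>+x. indicator (ball (a i) (5 * r i)) x \<partial>lebesgue)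
      = ennreal (5 ^ DIM('a)) * emeasure lebesgue (ball (a i) (r i))"
      using emeasure_ball_scale[of "r i" 5 "a i" "a i"] by simp
  qed
  also have "\<dots> = ennreal (5 ^ DIM('a)) * (\<integral>\<^sup>+i. emeasure lebesgue (ball (a i) (r i)) \<partial>count_space C)"
    by (rule nn_integral_cmult) simp
  finally have "\<tau> * emeasure lebesgue (\<Union>i\<in>K. ball (a i) (r i))
    \<le> \<tau> * (ennreal (5 ^ DIM('a)) * (\<integral>\<^sup>+i. emeasure lebesgue (ball (a i) (r i)) \<partial>count_space C))"
    by (rule mult_left_mono) simp
  also have "\<dots> = ennreal (5 ^ DIM('a)) * (\<integral>\<^sup>+i. \<tau> * emeasure lebesgue (ball (a i) (r i)) \<partial>count_space C)"
    by (subst nn_integral_cmult) (auto simp: mult_ac)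
  also have "\<dots> \<le> ennreal (5 ^ DIM('a)) * (\<integral>\<^sup>+i. (\<integral>\<^sup>+y\<in>ball (a i) (r i). h y \<partial>lebesgue) \<partial>count_space C)"
    using avg C(2) by (intro mult_left_mono nn_integral_mono) auto
  also have "(\<integral>\<^sup>+i. (\<integral>\<^sup>+y\<in>ball (a i) (r i). h y \<partial>lebesgue) \<partial>count_space C)
    = (\<integral>\<^sup>+y. (\<integral>\<^sup>+i. h y * indicator (ball (a i) (r i)) y \<partial>count_space C) \<partial>lebesgue)"
    by (rule nn_integral_count_space_nn_integral[OF C(1), symmetric]) auto
  also have "\<dots> \<le> (\<integral>\<^sup>+y\<in>G. h y \<partial>lebesgue)"
  proof (rule nn_integral_mono)
    fix y
    show "(\<integral>\<^sup>+i. h y * indicator (ball (a i) (r i)) y \<partial>count_space C) \<le> h y * indicator G y"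
    proof (cases "\<exists>i\<in>C. y \<in> ball (a i) (r i)")
      case True
      then obtain i where i: "i \<in> C" "y \<in> ball (a i) (r i)" by blast
      have "y \<in> G" using i G C(2) by blast
      \<comment> \<open>Disjointness leaves \<open>i\<close> as the only contributing index, so the
        sum carries no overlap factor.\<close>
      have "y \<notin> ball (a j) (r j)" if "j \<in> C" "j \<noteq> i" for j
        using disj i that unfolding pairwise_def disjnt_def by blast
      then have "(\<integral>\<^sup>+i. h y * indicator (ball (a i) (r i)) y \<partial>count_space C)
        = (\<Sum>j\<in>{i}. h y * indicator (ball (a j) (r j)) y)"
        using i by (intro nn_integral_count_space') (auto simp: indicator_def)
      also have "\<dots> \<le> h y * indicator G y"
        using i \<open>y \<in> G\<close> by simp
      finally show ?thesis .
    next
      case False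
      then have "(\<integral>\<^sup>+i. h y * indicator (ball (a i) (r i)) y \<partial>count_space C) = (\<integral>\<^sup>+i. 0 \<partial>count_space C)"
        by (intro nn_integral_cong) (auto simp: indicator_def)
      then show ?thesis by simp
    qed
  qed
  finally show ?thesis by (simp add: mult_left_mono)
qed

lemma tail_measurable:
  fixes h :: "'a \<Rightarrow> ennreal"
  assumes [measurable]: "h \<in> borel_measurable M"
  shows "(\<lambda>y. h y * indicator {y. h y > c} y) \<in> borel_measurable M"
proof -
  have "(\<lambda>y. h y * indicator {y. h y > c} y) = (\<lambda>y. if h y > c then h y else 0)"
    by (simp add: fun_eq_iff indicator_def)
  then show ?thesis by simp
qed

text \<open>The values of \<open>h\<close> up to \<open>\<tau>\<close> contribute at most
  \<open>\<tau>\<close> times the measure of \<open>A\<close>, which is half of the assumed lower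
  bound. Finiteness of that measure allows the half to be cancelled in
  \<open>ennreal\<close>.\<close>

lemma avg_tail:
  fixes h :: "'a \<Rightarrow> ennreal" and \<tau> :: real
  assumes [measurable]: "h \<in> borel_measurable M" "A \<in> sets M"
    and fin: "emeasure M A \<noteq> top" and "\<tau> \<ge> 0"
    and avg: "ennreal (2 * \<tau>) * emeasure M A \<le> (\<integral>\<^sup>+y\<in>A. h y \<partial>M)"
  shows "ennreal \<tau> * emeasure M A \<le> (\<integral>\<^sup>+y\<in>A. h y * indicator {y. h y > ennreal \<tau>} y \<partial>M)"
proof -
  have "ennreal \<tau> * emeasure M A + ennreal \<tau> * emeasure M A = ennreal (2 * \<tau>) * emeasure M A"
    using \<open>\<tau> \<ge> 0\<close> by (simp add: distrib_right[symmetric] ennreal_plus[symmetric] del: ennreal_plus)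
  also note avg
  also have "(\<integral>\<^sup>+y\<in>A. h y \<partial>M)
    \<le> (\<integral>\<^sup>+y. ennreal \<tau> * indicator A y + h y * indicator {y. h y > ennreal \<tau>} y * indicator A y \<partial>M)"
    by (intro nn_integral_mono) (auto simp: indicator_def)
  also have "\<dots> = ennreal \<tau> * emeasure M A
      + (\<integral>\<^sup>+y\<in>A. h y * indicator {y. h y > ennreal \<tau>} y \<partial>M)"
    using assms by (subst nn_integral_add)
      (auto intro!: borel_measurable_times_ennreal tail_measurable simp: nn_integral_cmult_indicator)
  finally show ?thesis
    using fin by (simp add: ennreal_add_left_cancel_le ennreal_mult_eq_top_iff)
qed

subsection \<open>The maximal function\<close>

lemma ennreal_le_cmultI:
  assumes "p > 0" "ennreal p * x \<le> y"
  shows "x \<le> ennreal (1 / p) * y"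
proof -
  have "x = ennreal (1 / p) * (ennreal p * x)"
    using \<open>p > 0\<close> by (simp add: mult.assoc[symmetric] ennreal_mult'[symmetric])
  also have "\<dots> \<le> ennreal (1 / p) * y"
    by (intro mult_left_mono assms) simp
  finally show ?thesis .
qed

text \<open>The supremum of \<open>HL_maximal\<close> kept in \<open>ennreal\<close>, for a
  nonnegative function that will be |f| divided by a norm parameter.\<close>

definition maxfun :: "('a::euclidean_space \<Rightarrow> ennreal) \<Rightarrow> 'a \<Rightarrow> ennreal" where
  "maxfun g x = (SUP (a, r)\<in>{(a, r). 0 < r \<and> x \<in> ball a r}.
     (\<integral>\<^sup>+y\<in>ball a r. g y \<partial>lebesgue) / emeasure lebesgue (ball a r))"

lemma less_maxfun_iff:
  "c < maxfun g x \<longleftrightarrow> (\<exists>a r. 0 < r \<and> x \<in> ball a r \<and>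
     c < (\<integral>\<^sup>+y\<in>ball a r. g y \<partial>lebesgue) / emeasure lebesgue (ball a r))"
  unfolding maxfun_def less_SUP_iff by auto

text \<open>The balls are open and need not be centred at the point, so a ball with a large average
  witnesses this for all of its points, and the superlevel set is a union of such balls.\<close>

lemma open_less_maxfun: "open {x. c < maxfun g x}"
proof -
  have "{x. c < maxfun g x} = (\<Union>(a, r)\<in>{(a, r). 0 < r \<and>
      c < (\<integral>\<^sup>+y\<in>ball a r. g y \<partial>lebesgue) / emeasure lebesgue (ball a r)}. ball a r)"
    unfolding less_maxfun_iff by blast
  then show ?thesis by (simp add: open_UN split_beta)
qed

lemma maxfun_measurable [measurable]: "maxfun g \<in> borel_measurable lebesgue"
  by (rule borel_measurableI_greater)
    (simp add: sets_completionI_sets borel_open open_less_maxfun)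

lemma maxfun_scale:
  assumes [measurable]: "g \<in> borel_measurable lebesgue" and "c > 0"
  shows "maxfun (\<lambda>y. g y / ennreal c) x = maxfun g x / ennreal c"
proof -
  have "(\<integral>\<^sup>+y\<in>ball a r. g y / ennreal c \<partial>lebesgue) / emeasure lebesgue (ball a r)
    = (\<integral>\<^sup>+y\<in>ball a r. g y \<partial>lebesgue) / emeasure lebesgue (ball a r) / ennreal c" for a r
  proof -
    have "(\<integral>\<^sup>+y\<in>ball a r. g y / ennreal c \<partial>lebesgue)
      = (\<integral>\<^sup>+y. g y * indicator (ball a r) y / ennreal c \<partial>lebesgue)"
      by (intro nn_integral_cong) (simp add: divide_ennreal_def mult_ac)
    also have "\<dots> = (\<integral>\<^sup>+y\<in>ball a r. g y \<partial>lebesgue) / ennreal c"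
      by (rule nn_integral_divide) simp
    finally show ?thesis by (simp add: divide_ennreal_def mult_ac)
  qed
  then show ?thesis
    unfolding maxfun_def by (subst SUP_divide_ennreal) (simp add: split_beta)
qed

text \<open>The part of \<open>{x. maxfun g x \<ge> 2\<tau>}\<close> that balls of radius at most \<open>r/2\<close> near \<open>ball a r\<close> detect;
  all of these balls lie in \<open>ball a (2r)\<close>.\<close>

definition local_set :: "('a::euclidean_space \<Rightarrow> ennreal) \<Rightarrow> 'a \<Rightarrow> real \<Rightarrow> real \<Rightarrow> 'a set" where
  "local_set g a r \<tau> = (\<Union>p\<in>{(b, s). 0 < s \<and> s \<le> r / 2 \<and> ball b s \<inter> ball a r \<noteq> {} \<and>
      ennreal (2 * \<tau>) * emeasure lebesgue (ball b s) \<le> (\<integral>\<^sup>+y\<in>ball b s. g y \<partial>lebesgue)}.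
    ball (fst p) (snd p))"

lemma local_set_measurable [measurable]: "local_set g a r \<tau> \<in> sets lebesgue"
  unfolding local_set_def by (simp add: sets_completionI_sets borel_open open_UN)

text \<open>The averages exceed 2\<open>\<tau>\<close>, so by \<open>avg_tail\<close> the truncated
  function still has averages at least \<open>\<tau>\<close>, and the covering estimate applies to
  it instead of \<open>g\<close>.\<close>

lemma local_set_bound:
  fixes a :: "'a::euclidean_space" and \<tau> :: real
  assumes [measurable]: "g \<in> borel_measurable lebesgue" and "\<tau> \<ge> 0"
  shows "ennreal \<tau> * emeasure lebesgue (local_set g a r \<tau>) \<le> ennreal (5 ^ DIM('a)) *
    (\<integral>\<^sup>+y\<in>ball a (2 * r). g y * indicator {y. g y > ennreal \<tau>} y \<partial>lebesgue)"
  unfolding local_set_def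
proof (rule vitali_weak_bound[where R = "r / 2"])
  show "(\<lambda>y. g y * indicator {y. g y > ennreal \<tau>} y) \<in> borel_measurable lebesgue"
    by (rule tail_measurable) simp
next
  fix p assume p: "p \<in> {(b, s). 0 < s \<and> s \<le> r / 2 \<and> ball b s \<inter> ball a r \<noteq> {} \<and>
      ennreal (2 * \<tau>) * emeasure lebesgue (ball b s) \<le> (\<integral>\<^sup>+y\<in>ball b s. g y \<partial>lebesgue)}"
  then show "0 < snd p \<and> snd p \<le> r / 2" by auto
  show "ennreal \<tau> * emeasure lebesgue (ball (fst p) (snd p)) \<le>
    (\<integral>\<^sup>+y\<in>ball (fst p) (snd p). g y * indicator {y. g y > ennreal \<tau>} y \<partial>lebesgue)"
    using p \<open>\<tau> \<ge> 0\<close> emeasure_ball_pos_finite(2)[of "snd p" "fst p"]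
    by (intro avg_tail) (auto split: prod.splits)
  \<comment> \<open>Through the common point \<open>z\<close>, every point of the small ball has
    distance less than r + 2 (r/2) from \<open>a\<close>.\<close>
  obtain z where z: "z \<in> ball (fst p) (snd p)" "z \<in> ball a r" using p by auto
  show "ball (fst p) (snd p) \<subseteq> ball a (2 * r)"
  proof
    fix y assume "y \<in> ball (fst p) (snd p)"
    then have "dist a y < r + snd p + snd p"
      using z dist_triangle[of a y z] dist_triangle[of z y "fst p"] by (simp add: dist_commute)
    then show "y \<in> ball a (2 * r)" using p by auto
  qed
qed

text \<open>The only information on \<open>g\<close> that the weak estimate for the maximal function needs. It follows
  from the modular inequality for the strong norm, and under the nabla-2 condition already from the
  one for the weak norm.\<close>

definition tail_bound ::
  "(ennreal \<Rightarrow> ennreal) \<Rightarrow> (real \<Rightarrow> real) \<Rightarrow> real \<Rightarrow> real \<Rightarrow> ('a::euclidean_space \<Rightarrow> ennreal) \<Rightarrow> bool"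
where
  "tail_bound \<Phi> \<phi> c D g \<longleftrightarrow> (\<forall>a r t. 0 < r \<longrightarrow> 0 < t \<longrightarrow>
     \<Phi> (ennreal t) * (\<integral>\<^sup>+y\<in>ball a r. g y * indicator {y. g y > ennreal (c * t)} y \<partial>lebesgue)
       \<le> ennreal (D * t * \<phi> r) * emeasure lebesgue (ball a r))"

text \<open>A witnessing ball of radius at most r/2 belongs to the family behind
  \<open>local_set\<close>. On a larger one, of radius s, \<open>avg_tail\<close> and
  \<open>tail_bound\<close> give c T \<open>\<Phi>\<close>(T) \<le> D T \<open>\<phi>\<close>(s);
  here T cancels and \<open>\<phi>\<close>(s) \<le> K \<open>\<phi>\<close>(r).\<close>

lemma maxfun_local_or_small:
  fixes a :: "'a::euclidean_space"
  assumes [measurable]: "g \<in> borel_measurable lebesgue"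
    and tb: "tail_bound \<Phi> \<phi> c D g" and pos: "c > 0" "D > 0" "T > 0" "r > 0"
    and K: "\<And>r s. 0 < r \<Longrightarrow> r / 2 < s \<Longrightarrow> \<phi> s \<le> K * \<phi> r"
    and x: "x \<in> ball a r" "ennreal (2 * (c * T)) < maxfun g x"
  shows "x \<in> local_set g a r (c * T) \<or> \<Phi> (ennreal T) \<le> ennreal (K * D / c * \<phi> r)"
proof -
  obtain b s where bs: "0 < s" "x \<in> ball b s"
    and avg: "ennreal (2 * (c * T)) < (\<integral>\<^sup>+y\<in>ball b s. g y \<partial>lebesgue) / emeasure lebesgue (ball b s)"
    using x unfolding less_maxfun_iff by blast
  let ?m = "emeasure lebesgue (ball b s)"
  have m: "?m \<noteq> 0" "?m \<noteq> top" using emeasure_ball_pos_finite[OF bs(1)] by auto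
  have "ennreal (2 * (c * T)) * ?m \<le> (\<integral>\<^sup>+y\<in>ball b s. g y \<partial>lebesgue) / ?m * ?m"
    using avg by (intro mult_right_mono) auto
  also have "\<dots> = (\<integral>\<^sup>+y\<in>ball b s. g y \<partial>lebesgue)"
    using ennreal_divide_self[of ?m] m by (simp only: ennreal_divide_times top.not_eq_extremum mult_1_right simp_thms)
  finally have le: "ennreal (2 * (c * T)) * ?m \<le> (\<integral>\<^sup>+y\<in>ball b s. g y \<partial>lebesgue)" .
  show ?thesis
  proof (cases "s \<le> r / 2")
    case True
    moreover have "ball b s \<inter> ball a r \<noteq> {}" using bs x by blast
    ultimately have "(b, s) \<in> {(b, s). 0 < s \<and> s \<le> r / 2 \<and> ball b s \<inter> ball a r \<noteq> {} \<and>
      ennreal (2 * (c * T)) * emeasure lebesgue (ball b s) \<le> (\<integral>\<^sup>+y\<in>ball b s. g y \<partial>lebesgue)}"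
      using bs(1) le by (intro CollectI case_prodI conjI)
    then have "x \<in> local_set g a r (c * T)"
      unfolding local_set_def by (rule UN_I) (simp only: fst_conv snd_conv bs)
    then show ?thesis ..
  next
    case False
    have "ennreal (c * T) * \<Phi> (ennreal T) * ?m = \<Phi> (ennreal T) * (ennreal (c * T) * ?m)"
      by (simp only: mult_ac)
    also have "\<dots> \<le> \<Phi> (ennreal T) *
        (\<integral>\<^sup>+y\<in>ball b s. g y * indicator {y. g y > ennreal (c * T)} y \<partial>lebesgue)"
      using pos m le by (intro mult_left_mono avg_tail) auto
    also have "\<dots> \<le> ennreal (D * T * \<phi> s) * ?m"
      using tb[unfolded tail_bound_def, rule_format, OF bs(1) pos(3)] .
    finally have "ennreal (c * T) * \<Phi> (ennreal T) \<le> ennreal (D * T * \<phi> s)"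
      using m by (metis ennreal_mult_le_mult_iff mult.commute)
    also have "\<dots> \<le> ennreal (D * T * (K * \<phi> r))"
      using pos K[of r s] False by (intro ennreal_leI mult_left_mono) auto
    finally have "\<Phi> (ennreal T) \<le> ennreal (1 / (c * T)) * ennreal (D * T * (K * \<phi> r))"
      using pos by (intro ennreal_le_cmultI) auto
    also have "\<dots> = ennreal (K * D / c * \<phi> r)"
      using pos by (subst ennreal_mult'[symmetric]) (auto simp: field_simps)
    finally show ?thesis by blast
  qed
qed

text \<open>The constant 10^n is 5^n from the covering lemma times 2^n from the doubled ball;
  \<open>K\<close> compares \<open>\<phi>\<close> at 2r with \<open>\<phi>\<close> at r, and 1/c
  remains after T cancels.\<close>

lemma local_set_tail_bound:
  fixes a :: "'a::euclidean_space"
  assumes [measurable]: "g \<in> borel_measurable lebesgue"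
    and tb: "tail_bound \<Phi> \<phi> c D g" and pos: "c > 0" "D > 0" "T > 0" "r > 0"
    and K: "\<And>r s. 0 < r \<Longrightarrow> r / 2 < s \<Longrightarrow> \<phi> s \<le> K * \<phi> r"
  shows "\<Phi> (ennreal T) * emeasure lebesgue (local_set g a r (c * T))
    \<le> ennreal (10 ^ DIM('a) * (K * D / c) * \<phi> r) * emeasure lebesgue (ball a r)"
proof -
  let ?E = "emeasure lebesgue (local_set g a r (c * T))"
  let ?I = "\<integral>\<^sup>+y\<in>ball a (2 * r). g y * indicator {y. g y > ennreal (c * T)} y \<partial>lebesgue"
  have "ennreal (c * T) * (\<Phi> (ennreal T) * ?E) = \<Phi> (ennreal T) * (ennreal (c * T) * ?E)"
    by (simp only: mult_ac)
  also have "\<dots> \<le> \<Phi> (ennreal T) * (ennreal (5 ^ DIM('a)) * ?I)"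
    using pos by (intro mult_left_mono local_set_bound) auto
  also have "\<dots> = ennreal (5 ^ DIM('a)) * (\<Phi> (ennreal T) * ?I)"
    by (simp only: mult_ac)
  also have "\<dots> \<le> ennreal (5 ^ DIM('a)) * (ennreal (D * T * \<phi> (2 * r)) * emeasure lebesgue (ball a (2 * r)))"
    using tb[unfolded tail_bound_def, rule_format, of "2 * r" T a] pos by (intro mult_left_mono) simp_all
  also have "\<dots> \<le> ennreal (5 ^ DIM('a)) * (ennreal (D * T * (K * \<phi> r)) * emeasure lebesgue (ball a (2 * r)))"
    using pos K[of r "2 * r"] by (intro mult_left_mono mult_right_mono ennreal_leI) auto
  also have "\<dots> = ennreal (5 ^ DIM('a)) * (ennreal (D * T * (K * \<phi> r)) *
      (ennreal (2 ^ DIM('a)) * emeasure lebesgue (ball a r)))"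
    using emeasure_ball_scale[of r 2 a a] pos by simp
  also have "\<dots> = ennreal (5 ^ DIM('a) * 2 ^ DIM('a) * (D * T * (K * \<phi> r))) * emeasure lebesgue (ball a r)"
    by (simp only: ennreal_mult' zero_le_power zero_le_numeral zero_le_mult_iff simp_thms) (simp only: mult_ac)
  finally have "\<Phi> (ennreal T) * ?E \<le> ennreal (1 / (c * T)) *
      (ennreal (5 ^ DIM('a) * 2 ^ DIM('a) * (D * T * (K * \<phi> r))) * emeasure lebesgue (ball a r))"
    using pos by (intro ennreal_le_cmultI) auto
  also have "\<dots> = ennreal (1 / (c * T) * (5 ^ DIM('a) * 2 ^ DIM('a) * (D * T * (K * \<phi> r))))
      * emeasure lebesgue (ball a r)"
    using pos by (subst ennreal_mult') (auto simp: mult.assoc)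
  also have "1 / (c * T) * (5 ^ DIM('a) * 2 ^ DIM('a) * (D * T * (K * \<phi> r)))
      = (5 * 2) ^ DIM('a) * (K * D / c) * \<phi> r"
    using pos unfolding power_mult_distrib by (simp add: field_simps)
  finally show ?thesis by simp
qed

text \<open>The second alternative of \<open>maxfun_local_or_small\<close> does not mention the
  point. Either it holds, and the measure of the whole ball is an adequate bound, or it fails, and
  every point of the set lies in \<open>local_set\<close>.\<close>

lemma maxfun_weak_bound:
  fixes a :: "'a::euclidean_space"
  assumes [measurable]: "g \<in> borel_measurable lebesgue"
    and tb: "tail_bound \<Phi> \<phi> c D g" and pos: "c > 0" "D > 0" "T > 0" "r > 0" "K > 0" "\<phi> r > 0"
    and K: "\<And>r s. 0 < r \<Longrightarrow> r / 2 < s \<Longrightarrow> \<phi> s \<le> K * \<phi> r"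
  shows "\<Phi> (ennreal T) * emeasure lebesgue {x \<in> ball a r. ennreal (2 * (c * T)) < maxfun g x}
    \<le> ennreal (10 ^ DIM('a) * (K * D / c) * \<phi> r) * emeasure lebesgue (ball a r)"
    (is "_ * emeasure _ ?S \<le> ?R")
proof (cases "\<Phi> (ennreal T) \<le> ennreal (K * D / c * \<phi> r)")
  case True
  have "(1::real) \<le> 10 ^ DIM('a)" by simp
  then have "1 * (K * D / c * \<phi> r) \<le> 10 ^ DIM('a) * (K * D / c * \<phi> r)"
    using pos by (intro mult_right_mono) auto
  then have "\<Phi> (ennreal T) \<le> ennreal (10 ^ DIM('a) * (K * D / c) * \<phi> r)"
    using True by (auto simp: mult.assoc intro: order_trans ennreal_leI)
  moreover have "emeasure lebesgue ?S \<le> emeasure lebesgue (ball a r)"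
    by (intro emeasure_mono) auto
  ultimately show ?thesis by (intro mult_mono) auto
next
  case False
  have "?S \<subseteq> local_set g a r (c * T)"
    using maxfun_local_or_small[OF assms(1) tb pos(1-4) K] False by blast
  then have "emeasure lebesgue ?S \<le> emeasure lebesgue (local_set g a r (c * T))"
    by (intro emeasure_mono) auto
  then have "\<Phi> (ennreal T) * emeasure lebesgue ?S
      \<le> \<Phi> (ennreal T) * emeasure lebesgue (local_set g a r (c * T))"
    by (intro mult_left_mono) auto
  also have "\<dots> \<le> ?R" by (rule local_set_tail_bound[OF assms(1) tb pos(1-4) K])
  finally show ?thesis .
qed

subsection \<open>Consequences of quasi-convexity and of the nabla-2 condition\<close>

text \<open>Dividing by \<open>c\<close> on the side of \<open>f\<close> confines the measurability
  requirement to \<open>f\<close>; in the applications \<open>h\<close> contains a composition with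
  \<open>\<Phi>\<close>.\<close>

lemma nn_integral_le_cmult:
  assumes [measurable]: "f \<in> borel_measurable M" and "c > 0"
    and le: "\<And>x. f x \<le> ennreal c * h x"
  shows "(\<integral>\<^sup>+x. f x \<partial>M) \<le> ennreal c * (\<integral>\<^sup>+x. h x \<partial>M)"
proof -
  have "ennreal (1 / c) * (\<integral>\<^sup>+x. f x \<partial>M) = (\<integral>\<^sup>+x. ennreal (1 / c) * f x \<partial>M)"
    by (rule nn_integral_cmult[symmetric]) simp
  also have "\<dots> \<le> (\<integral>\<^sup>+x. h x \<partial>M)"
  proof (rule nn_integral_mono)
    fix x
    have "ennreal (1 / c) * f x \<le> ennreal (1 / c) * (ennreal c * h x)"
      by (intro mult_left_mono le) simp
    also have "\<dots> = h x"
      using \<open>c > 0\<close> by (simp add: mult.assoc[symmetric] ennreal_mult'[symmetric])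
    finally show "ennreal (1 / c) * f x \<le> h x" .
  qed
  finally have "(\<integral>\<^sup>+x. f x \<partial>M) \<le> ennreal (1 / (1 / c)) * (\<integral>\<^sup>+x. h x \<partial>M)"
    using \<open>c > 0\<close> by (intro ennreal_le_cmultI) auto
  then show ?thesis by simp
qed

lemma suminf_half: "(\<Sum>j. ennreal ((1 / 2) ^ j)) = 2"
proof -
  have "(\<lambda>j. (1 / 2 :: real) ^ j) sums 2"
    using geometric_sums[of "1 / 2 :: real"] by simp
  then show ?thesis
    by (subst suminf_ennreal_eq[of _ 2]) auto
qed

lemma ennreal_term_le_suminf: "(f j :: ennreal) \<le> (\<Sum>j. f j)"
  using sum_le_suminf[of f "{j}"] by (simp add: summableI)

lemma ennreal_topI:
  assumes "\<And>M. 0 \<le> M \<Longrightarrow> ennreal M \<le> x"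
  shows "x = top"
proof (cases x)
  case (real r)
  then show ?thesis using assms[of "r + 1"] by simp
qed

text \<open>What remains of convexity when \<open>\<Phi>\<close> is only equivalent to a Young function. It replaces Jensen's
  inequality and also absorbs multiplicative constants into the norm.\<close>

definition quasi_convex :: "real \<Rightarrow> (ennreal \<Rightarrow> ennreal) \<Rightarrow> bool" where
  "quasi_convex A \<Phi> \<longleftrightarrow>
     (\<forall>\<theta> s. 0 < \<theta> \<longrightarrow> \<theta> \<le> 1 \<longrightarrow> \<Phi> (ennreal (\<theta> / A) * s) \<le> ennreal \<theta> * \<Phi> s)"

text \<open>Convexity between 0 and half of the argument, together with the value 0 at 0, gives the
  factor \<open>\<theta>\<close>; the constant 2 pays for the halving.\<close>

lemma Phi_Y_quasi_convex:
  assumes "\<Psi> \<in> Phi_Y"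
  shows "quasi_convex 2 \<Psi>"
  unfolding quasi_convex_def
proof (intro allI impI)
  fix \<theta> :: real and s :: ennreal
  assume \<theta>: "0 < \<theta>" "\<theta> \<le> 1"
  from assms have mono: "mono \<Psi>" and zero: "\<Psi> 0 = 0" and b0: "0 < b_of \<Psi>"
    and top: "b_of \<Psi> = \<infinity> \<Longrightarrow> \<Psi> \<infinity> = \<infinity>"
    and conv: "convex_on {t. 0 \<le> t \<and> ennreal t < b_of \<Psi>} (\<lambda>t. enn2real (\<Psi> (ennreal t)))"
    unfolding Phi_Y_def Phi_bar_def by auto
  show "\<Psi> (ennreal (\<theta> / 2) * s) \<le> ennreal \<theta> * \<Psi> s"
  proof (cases "\<Psi> s = top \<or> s = 0")
    case True
    then show ?thesis using \<theta> zero by (auto simp: ennreal_mult_top)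
  next
    case False
    \<comment> \<open>Monotonicity keeps a point of finite value from lying beyond
      \<open>b_of \<Psi>\<close>, though it may coincide with it.\<close>
    have below: "s \<le> b_of \<Psi>"
      unfolding b_of_def
    proof (rule Inf_greatest)
      fix t assume "t \<in> {t. \<Psi> t = \<infinity>}"
      then show "s \<le> t"
        using False monoD[OF mono, of t s] by (metis infinity_ennreal_def mem_Collect_eq nle_le top_unique)
    qed
    \<comment> \<open>This rules out \<open>s = top\<close>, so that only positive reals
      remain.\<close>
    have "\<Psi> top = top"
    proof (cases "b_of \<Psi> = \<infinity>")
      case True
      then show ?thesis using top by simp
    next
      case False
      then obtain t where "\<Psi> t = \<infinity>"
        unfolding b_of_def by (cases "{t. \<Psi> t = \<infinity>} = {}") auto
      then show ?thesis using monoD[OF mono, of t top] by (simp add: top_unique)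
    qed
    with False obtain x where x: "s = ennreal x" "x > 0"
      by (cases s) (auto simp: less_le)
    \<comment> \<open>Halving the argument moves it strictly below \<open>b_of \<Psi>\<close>, so the boundary point needs no limit argument.\<close>
    have half: "ennreal (x / 2) < b_of \<Psi>"
      using x below by (intro less_le_trans[OF _ below]) (auto simp: ennreal_less_iff)
    have fin: "\<Psi> (ennreal y) < top" if "y \<le> x" for y
      using monoD[OF mono, of "ennreal y" s] False x that
      by (auto simp: less_top[symmetric] ennreal_leI top_unique)
    have "\<theta> * x \<le> 1 * x" using \<theta> x by (intro mult_right_mono) auto
    then have le: "\<theta> * (x / 2) \<le> x" using x by simp
    have "enn2real (\<Psi> (ennreal ((1 - \<theta>) *\<^sub>R 0 + \<theta> *\<^sub>R (x / 2))))
      \<le> (1 - \<theta>) * enn2real (\<Psi> (ennreal 0)) + \<theta> * enn2real (\<Psi> (ennreal (x / 2)))"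
      using \<theta> x half b0 by (intro convex_onD[OF conv]) auto
    then have "enn2real (\<Psi> (ennreal (\<theta> * (x / 2)))) \<le> \<theta> * enn2real (\<Psi> (ennreal (x / 2)))"
      using zero by simp
    then have "ennreal (enn2real (\<Psi> (ennreal (\<theta> * (x / 2)))))
      \<le> ennreal (\<theta> * enn2real (\<Psi> (ennreal (x / 2))))"
      by (rule ennreal_leI)
    then have "\<Psi> (ennreal (\<theta> * (x / 2))) \<le> ennreal \<theta> * \<Psi> (ennreal (x / 2))"
      using \<theta> x fin[OF le] fin[of "x / 2"] by (simp add: ennreal_mult')
    also have "\<dots> \<le> ennreal \<theta> * \<Psi> s"
      using x by (intro mult_left_mono monoD[OF mono]) (auto intro: ennreal_leI)
    finally show ?thesis using x \<theta> by (simp add: ennreal_mult'[symmetric])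
  qed
qed

text \<open>Passing to the Young function and back costs one factor C each way, and its own
  quasi-convexity costs 2, whence 2 C^2. The maximum with 1 secures
  \<open>A \<ge> 1\<close>.\<close>

lemma Phi_bar_Y_quasi_convex:
  assumes "\<Phi> \<in> Phi_bar_Y"
  obtains A where "A \<ge> 1" "quasi_convex A \<Phi>"
proof -
  from assms obtain \<Psi> C where \<Psi>: "\<Psi> \<in> Phi_Y" and mono: "mono \<Phi>" and C: "C > (0::real)"
    and eq: "\<And>t. \<Phi> (ennreal (inverse C) * t) \<le> \<Psi> t" "\<And>t. \<Psi> t \<le> \<Phi> (ennreal C * t)"
    unfolding Phi_bar_Y_def Phi_equiv_def Phi_bar_def by auto
  let ?A = "max 1 (2 * C\<^sup>2)"
  have "\<Phi> (ennreal (\<theta> / ?A) * s) \<le> ennreal \<theta> * \<Phi> s" if \<theta>: "0 < \<theta>" "\<theta> \<le> 1" for \<theta> s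
  proof -
    have "\<theta> / ?A \<le> \<theta> / (2 * C\<^sup>2)" using \<theta> C by (intro divide_left_mono) auto
    then have "\<Phi> (ennreal (\<theta> / ?A) * s) \<le> \<Phi> (ennreal (\<theta> / (2 * C\<^sup>2)) * s)"
      by (intro monoD[OF mono] mult_right_mono ennreal_leI) auto
    also have "ennreal (\<theta> / (2 * C\<^sup>2)) * s
      = ennreal (inverse C) * (ennreal (\<theta> / 2) * (ennreal (inverse C) * s))"
    proof -
      have "\<theta> / (2 * C\<^sup>2) = inverse C * (\<theta> / 2 * inverse C)"
        using C by (simp add: field_simps power2_eq_square)
      then have "ennreal (\<theta> / (2 * C\<^sup>2)) = ennreal (inverse C * (\<theta> / 2 * inverse C))"
        by (rule arg_cong)
      also have "\<dots> = ennreal (inverse C) * (ennreal (\<theta> / 2) * ennreal (inverse C))"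
        using ennreal_mult'[of "inverse C" "\<theta> / 2 * inverse C"] ennreal_mult'[of "\<theta> / 2" "inverse C"] \<theta> C
        by auto
      finally show ?thesis by (simp only: mult.assoc)
    qed
    also have "\<Phi> \<dots> \<le> \<Psi> (ennreal (\<theta> / 2) * (ennreal (inverse C) * s))" by (rule eq)
    also have "\<dots> \<le> ennreal \<theta> * \<Psi> (ennreal (inverse C) * s)"
      using Phi_Y_quasi_convex[OF \<Psi>] \<theta> unfolding quasi_convex_def by blast
    also have "\<dots> \<le> ennreal \<theta> * \<Phi> (ennreal C * (ennreal (inverse C) * s))"
      by (intro mult_left_mono eq) auto
    also have "ennreal C * (ennreal (inverse C) * s) = s"
      using C by (simp add: mult.assoc[symmetric] ennreal_mult'[symmetric])
    finally show ?thesis .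
  qed
  then show ?thesis using that[of ?A] unfolding quasi_convex_def by simp
qed

text \<open>This is the case \<open>\<theta> = 1 / D\<close>. It trades a constant \<open>D\<close>
  in a modular inequality for a factor \<open>A * D\<close> in the norm.\<close>

lemma quasi_convex_divide:
  assumes "quasi_convex A \<Phi>" "A \<ge> 1" "D \<ge> 1"
  shows "\<Phi> s \<le> ennreal (1 / D) * \<Phi> (ennreal (A * D) * s)"
proof -
  have "\<Phi> (ennreal ((1 / D) / A) * (ennreal (A * D) * s)) \<le> ennreal (1 / D) * \<Phi> (ennreal (A * D) * s)"
    using assms(1)[unfolded quasi_convex_def, rule_format, of "1 / D"] \<open>D \<ge> 1\<close> by (simp del: divide_divide_eq_left)
  moreover have "ennreal ((1 / D) / A) * (ennreal (A * D) * s) = s"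
    using assms by (simp add: mult.assoc[symmetric] ennreal_mult'[symmetric])
  ultimately show ?thesis by simp
qed

text \<open>Just beyond the zero set \<open>\<Phi>\<close> is positive, and from there
  \<open>quasi_convex_divide\<close> forces at least linear growth.\<close>

lemma quasi_convex_unbounded:
  assumes q: "quasi_convex A \<Phi>" and "A \<ge> 1" and a: "a_of \<Phi> < \<infinity>" and "M \<ge> 0"
  obtains T where "T > 0" "ennreal M < \<Phi> (ennreal T)"
proof -
  obtain x where x: "a_of \<Phi> + 1 = ennreal x" "x \<ge> 0"
    using a by (cases "a_of \<Phi> + 1") auto
  have "x > 0" using x by (cases "x = 0") auto
  have "a_of \<Phi> < a_of \<Phi> + 1"
    using a by (cases "a_of \<Phi>") (auto simp: ennreal_plus[symmetric] ennreal_1[symmetric] ennreal_less_iff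
        simp del: ennreal_plus ennreal_1)
  then have ne: "\<Phi> (ennreal x) \<noteq> 0"
    using x Sup_upper[of "ennreal x" "{t. \<Phi> t = 0}"] unfolding a_of_def by auto
  show ?thesis
  proof (cases "\<Phi> (ennreal x) = top")
    case True
    then show ?thesis using that[of x] \<open>x > 0\<close> by simp
  next
    case False
    with ne obtain p where p: "\<Phi> (ennreal x) = ennreal p" "p > 0"
      by (cases "\<Phi> (ennreal x)") (auto simp: less_le)
    \<comment> \<open>The second entry makes D p at least M + 1, hence strictly larger than
      M.\<close>
    define D where "D = max 1 ((M + 1) / p)"
    have D: "D \<ge> 1" "M < D * p" using p \<open>M \<ge> 0\<close> by (auto simp: D_def max_def field_simps)
    have "ennreal (1 / D) * ennreal M < ennreal p"
      using D \<open>M \<ge> 0\<close> by (simp add: ennreal_mult'[symmetric] ennreal_less_iff field_simps)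
    also have "ennreal p \<le> ennreal (1 / D) * \<Phi> (ennreal (A * D) * ennreal x)"
      using quasi_convex_divide[OF q \<open>A \<ge> 1\<close> D(1), of "ennreal x"] p by simp
    finally have "ennreal M < \<Phi> (ennreal (A * D) * ennreal x)"
      by (meson mult_left_mono not_le zero_le)
    then show ?thesis
      using that[of "A * D * x"] \<open>x > 0\<close> \<open>A \<ge> 1\<close> D by (simp add: ennreal_mult')
  qed
qed

lemma quasi_convex_top:
  assumes "quasi_convex A \<Phi>" "A \<ge> 1" "a_of \<Phi> < \<infinity>" "mono \<Phi>"
  shows "\<Phi> top = top"
proof (rule ennreal_topI)
  fix M :: real assume "M \<ge> 0"
  then obtain T where "ennreal M < \<Phi> (ennreal T)"
    using quasi_convex_unbounded assms by blast
  also have "\<dots> \<le> \<Phi> top" by (intro monoD[OF assms(4)]) simp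
  finally show "ennreal M \<le> \<Phi> top" by simp
qed

text \<open>At a value s of g, quasi-convexity is used with \<open>\<theta>\<close> = A t / s. This
  is at most 1 on the tail s > A t, which explains the threshold c = A; multiplying by s leaves the
  factor A t, hence D = A.\<close>

lemma tail_bound_strong:
  fixes g :: "'a::euclidean_space \<Rightarrow> ennreal"
  assumes [measurable]: "g \<in> borel_measurable lebesgue"
    and q: "quasi_convex A \<Phi>" and "A \<ge> 1" and top: "\<Phi> top = top"
    and bd: "\<And>a r. r > 0 \<Longrightarrow> (\<integral>\<^sup>+y\<in>ball a r. \<Phi> (g y) \<partial>lebesgue) \<le> ennreal (\<phi> r) * emeasure lebesgue (ball a r)"
  shows "tail_bound \<Phi> \<phi> A A g"
  unfolding tail_bound_def
proof (intro allI impI)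
  fix a :: 'a and r t :: real
  assume "0 < r" "0 < t"
  let ?f = "\<lambda>y. g y * indicator {y. g y > ennreal (A * t)} y"
  note tail_measurable[OF assms(1), measurable]
  have At: "A * t > 0" using \<open>A \<ge> 1\<close> \<open>t > 0\<close> by simp
  have pw: "\<Phi> (ennreal t) * s \<le> ennreal (A * t) * \<Phi> s" if s: "ennreal (A * t) < s" for s
  proof (cases s)
    case (real x)
    then have x: "A * t < x" "x > 0" using s At by (auto simp: ennreal_less_iff)
    have "\<Phi> (ennreal ((A * t / x) / A) * ennreal x) \<le> ennreal (A * t / x) * \<Phi> (ennreal x)"
    proof -
      have "0 < A * t / x" "A * t / x \<le> 1" using x At by auto
      then show ?thesis by (rule q[unfolded quasi_convex_def, rule_format])
    qed
    moreover have "ennreal ((A * t / x) / A) * ennreal x = ennreal t"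
      using x \<open>A \<ge> 1\<close> \<open>t > 0\<close> by (simp add: ennreal_mult'[symmetric])
    ultimately have "\<Phi> (ennreal t) * ennreal x \<le> ennreal (A * t / x) * \<Phi> (ennreal x) * ennreal x"
      by (simp add: mult_right_mono)
    also have "\<dots> = (ennreal (A * t / x) * ennreal x) * \<Phi> (ennreal x)"
      by (simp only: mult_ac)
    also have "ennreal (A * t / x) * ennreal x = ennreal (A * t)"
      using x At by (simp add: ennreal_mult'[symmetric])
    finally show ?thesis using real by simp
  next
    case top
    have "ennreal (A * t) * top = top"
      using At by (intro ennreal_top_mult_left) (metis ennreal_eq_0_iff not_le)
    then show ?thesis using top \<open>\<Phi> top = top\<close> by simp
  qed
  have "\<Phi> (ennreal t) * (\<integral>\<^sup>+y\<in>ball a r. ?f y \<partial>lebesgue)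
    = (\<integral>\<^sup>+y. \<Phi> (ennreal t) * (?f y * indicator (ball a r) y) \<partial>lebesgue)"
    by (rule nn_integral_cmult[symmetric]) measurable
  also have "\<dots> \<le> ennreal (A * t) * (\<integral>\<^sup>+y\<in>ball a r. \<Phi> (g y) \<partial>lebesgue)"
  proof (rule nn_integral_le_cmult[OF _ At])
    show "\<Phi> (ennreal t) * (?f y * indicator (ball a r) y)
      \<le> ennreal (A * t) * (\<Phi> (g y) * indicator (ball a r) y)" for y
      using pw[of "g y"] by (auto simp: indicator_def)
  qed measurable
  also have "\<dots> \<le> ennreal (A * t) * (ennreal (\<phi> r) * emeasure lebesgue (ball a r))"
    by (intro mult_left_mono bd \<open>0 < r\<close>) simp
  also have "\<dots> = ennreal (A * t * \<phi> r) * emeasure lebesgue (ball a r)"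
    using At by (subst ennreal_mult') (auto simp: mult.assoc)
  finally show "\<Phi> (ennreal t) * (\<integral>\<^sup>+y\<in>ball a r. ?f y \<partial>lebesgue)
    \<le> ennreal (A * t * \<phi> r) * emeasure lebesgue (ball a r)" .
qed

section \<open>Geometric decay under the nabla-2 condition\<close>

definition nabla2_with :: "real \<Rightarrow> (ennreal \<Rightarrow> ennreal) \<Rightarrow> bool" where
  "nabla2_with k \<Phi> \<longleftrightarrow> k > 1 \<and> (\<forall>t > 0. \<Phi> t \<le> ennreal (1 / (2 * k)) * \<Phi> (ennreal k * t))"

text \<open>Each step multiplies the argument by k and gains 2k in value. The spare factor 2 is what
  leaves a series of ratio 1/2 once the levels k^i have been multiplied in.\<close>

lemma nabla2_with_iterate:
  assumes "nabla2_with k \<Phi>" "t > 0"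
  shows "\<Phi> (ennreal t) \<le> ennreal ((1 / (2 * k)) ^ i) * \<Phi> (ennreal (k ^ i * t))"
proof (induction i)
  case (Suc i)
  have k: "k > 1" and n: "\<And>t. t > 0 \<Longrightarrow> \<Phi> t \<le> ennreal (1 / (2 * k)) * \<Phi> (ennreal k * t)"
    using assms unfolding nabla2_with_def by auto
  note Suc
  also have "\<Phi> (ennreal (k ^ i * t)) \<le> ennreal (1 / (2 * k)) * \<Phi> (ennreal k * ennreal (k ^ i * t))"
    using k assms by (intro n) simp
  also have "ennreal k * ennreal (k ^ i * t) = ennreal (k ^ Suc i * t)"
    using k by (simp add: ennreal_mult'[symmetric] mult_ac)
  also have "ennreal ((1 / (2 * k)) ^ i) * (ennreal (1 / (2 * k)) * \<Phi> (ennreal (k ^ Suc i * t)))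
    = ennreal ((1 / (2 * k)) ^ Suc i) * \<Phi> (ennreal (k ^ Suc i * t))"
  proof -
    have "ennreal ((1 / (2 * k)) ^ Suc i) = ennreal ((1 / (2 * k)) ^ i) * ennreal (1 / (2 * k))"
      unfolding power_Suc2 using k by (intro ennreal_mult) auto
    then show ?thesis by (simp only: mult.assoc)
  qed
  finally show ?case by (simp add: mult_left_mono)
qed simp

text \<open>For finite \<open>s\<close> a single summand suffices, the one whose layer contains
  \<open>s\<close>. For \<open>s = top\<close> every indicator is 1 and the summands are
  unbounded.\<close>

lemma le_geometric_layers:
  fixes s :: ennreal
  assumes "k > 1" "t > 0" "ennreal t < s"
  shows "s \<le> (\<Sum>j. ennreal (k ^ Suc j * t) * indicator {ennreal (k ^ j * t)<..} s)"
    (is "_ \<le> suminf ?f")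
proof (cases s)
  case (real x)
  then have "t < x" using assms by (simp add: ennreal_less_iff)
  obtain n where "x / t < k ^ n" using real_arch_pow[OF \<open>k > 1\<close>] by blast
  also have "k ^ n \<le> k ^ Suc n" using \<open>k > 1\<close> by simp
  finally have "x \<le> k ^ Suc n * t" using \<open>t > 0\<close> by (simp add: field_simps)
  define j where "j = (LEAST j. x \<le> k ^ Suc j * t)"
  have j: "x \<le> k ^ Suc j * t" unfolding j_def by (rule LeastI) fact
  have "k ^ j * t < x"
  \<comment> \<open>Minimality gives the lower bound only for a successor index; at index 0 it is
    the assumption that \<open>s\<close> exceeds \<open>t\<close>.\<close>
  proof (cases j)
    case (Suc i)
    then have "\<not> x \<le> k ^ Suc i * t" using not_less_Least[of i "\<lambda>j. x \<le> k ^ Suc j * t"] unfolding j_def by auto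
    then show ?thesis using Suc by simp
  qed (use \<open>t < x\<close> in simp)
  then have "ennreal (k ^ j * t) < ennreal x" using assms by (simp add: ennreal_less_iff)
  then have "s \<le> ?f j" using j real by (simp add: ennreal_leI)
  also have "\<dots> \<le> suminf ?f" by (rule ennreal_term_le_suminf)
  finally show ?thesis .
next
  case top
  have "suminf ?f = top"
  proof (rule ennreal_topI)
    fix M :: real assume "M \<ge> 0"
    obtain n where "M / t < k ^ n" using real_arch_pow[OF \<open>k > 1\<close>] by blast
    also have "k ^ n \<le> k ^ Suc n" using \<open>k > 1\<close> by simp
    finally have "M \<le> k ^ Suc n * t" using \<open>t > 0\<close> by (simp add: field_simps)
    then have "ennreal M \<le> ?f n" using top by (simp add: ennreal_leI)
    also have "\<dots> \<le> suminf ?f" by (rule ennreal_term_le_suminf)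
    finally show "ennreal M \<le> suminf ?f" .
  qed
  then show ?thesis by simp
qed

text \<open>In layer j the height k^(j+1) t is compensated by the decay (2k)^(-j) of
  \<open>\<Phi>\<close> between t and k^j t, while the weak inequality is applied at level k^j t.
  This leaves k t 2^(-j), and summation over j gives D = 2k with threshold c = 1.\<close>

lemma tail_bound_weak:
  fixes g :: "'a::euclidean_space \<Rightarrow> ennreal"
  assumes [measurable]: "g \<in> borel_measurable lebesgue"
    and n: "nabla2_with k \<Phi>" and \<phi>: "\<And>r. r > 0 \<Longrightarrow> \<phi> r > 0"
    and bd: "\<And>a r t. r > 0 \<Longrightarrow> t > 0 \<Longrightarrow>
      \<Phi> (ennreal t) * emeasure lebesgue {x \<in> ball a r. g x > ennreal t}
        \<le> ennreal (\<phi> r) * emeasure lebesgue (ball a r)"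
  shows "tail_bound \<Phi> \<phi> 1 (2 * k) g"
  unfolding tail_bound_def
proof (intro allI impI)
  fix a :: 'a and r t :: real
  assume r: "0 < r" and t: "0 < t"
  have k: "k > 1" using n unfolding nabla2_with_def by simp
  let ?E = "\<lambda>j. {x \<in> ball a r. g x > ennreal (k ^ j * t)}"
  have E [measurable]: "?E j \<in> sets lebesgue" for j by measurable
  have "(\<integral>\<^sup>+y\<in>ball a r. g y * indicator {y. g y > ennreal (1 * t)} y \<partial>lebesgue)
    \<le> (\<integral>\<^sup>+y. (\<Sum>j. ennreal (k ^ Suc j * t) * indicator (?E j) y) \<partial>lebesgue)"
  proof (rule nn_integral_mono)
    fix y
    show "g y * indicator {y. g y > ennreal (1 * t)} y * indicator (ball a r) y
      \<le> (\<Sum>j. ennreal (k ^ Suc j * t) * indicator (?E j) y)"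
    proof (cases "y \<in> ball a r \<and> ennreal t < g y")
      case True
      then have "g y \<le> (\<Sum>j. ennreal (k ^ Suc j * t) * indicator {ennreal (k ^ j * t)<..} (g y))"
        by (intro le_geometric_layers k t) simp
      also have "\<dots> = (\<Sum>j. ennreal (k ^ Suc j * t) * indicator (?E j) y)"
        using True by (simp add: indicator_def)
      finally show ?thesis using True by simp
    qed (auto simp: indicator_def)
  qed
  also have "\<dots> = (\<Sum>j. \<integral>\<^sup>+y. ennreal (k ^ Suc j * t) * indicator (?E j) y \<partial>lebesgue)"
    by (rule nn_integral_suminf) measurable
  also have "\<dots> = (\<Sum>j. ennreal (k ^ Suc j * t) * emeasure lebesgue (?E j))"
    by (intro arg_cong[where f = suminf] ext nn_integral_cmult_indicator E)
  finally have "\<Phi> (ennreal t) * (\<integral>\<^sup>+y\<in>ball a r. g y * indicator {y. g y > ennreal (1 * t)} y \<partial>lebesgue)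
    \<le> \<Phi> (ennreal t) * (\<Sum>j. ennreal (k ^ Suc j * t) * emeasure lebesgue (?E j))"
    by (intro mult_left_mono) auto
  also have "\<dots> = (\<Sum>j. \<Phi> (ennreal t) * (ennreal (k ^ Suc j * t) * emeasure lebesgue (?E j)))"
    by (rule ennreal_suminf_cmult[symmetric])
  also have "\<dots> \<le> (\<Sum>j. ennreal ((1 / 2) ^ j) * (ennreal (k * t * \<phi> r) * emeasure lebesgue (ball a r)))"
  proof (intro suminf_le summableI)
    fix j
    have "\<Phi> (ennreal t) * (ennreal (k ^ Suc j * t) * emeasure lebesgue (?E j))
      \<le> ennreal ((1 / (2 * k)) ^ j) * \<Phi> (ennreal (k ^ j * t)) * (ennreal (k ^ Suc j * t) * emeasure lebesgue (?E j))"
      by (intro mult_right_mono nabla2_with_iterate[OF n t]) simp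
    also have "\<dots> = (ennreal ((1 / (2 * k)) ^ j) * ennreal (k ^ Suc j * t)) *
        (\<Phi> (ennreal (k ^ j * t)) * emeasure lebesgue (?E j))"
      by (simp only: mult_ac)
    also have "\<dots> \<le> (ennreal ((1 / (2 * k)) ^ j) * ennreal (k ^ Suc j * t)) *
        (ennreal (\<phi> r) * emeasure lebesgue (ball a r))"
      using k t by (intro mult_left_mono bd r) auto
    also have "ennreal ((1 / (2 * k)) ^ j) * ennreal (k ^ Suc j * t) = ennreal ((1 / 2) ^ j) * ennreal (k * t)"
      using k t by (simp add: ennreal_mult'[symmetric] power_divide field_simps)
    also have "ennreal ((1 / 2) ^ j) * ennreal (k * t) * (ennreal (\<phi> r) * emeasure lebesgue (ball a r))
      = ennreal ((1 / 2) ^ j) * (ennreal (k * t * \<phi> r) * emeasure lebesgue (ball a r))"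
      using k t ennreal_mult'[of "k * t" "\<phi> r"] by (simp add: mult.assoc)
    finally show "\<Phi> (ennreal t) * (ennreal (k ^ Suc j * t) * emeasure lebesgue (?E j))
      \<le> ennreal ((1 / 2) ^ j) * (ennreal (k * t * \<phi> r) * emeasure lebesgue (ball a r))" .
  qed
  also have "\<dots> = 2 * (ennreal (k * t * \<phi> r) * emeasure lebesgue (ball a r))"
    by (simp only: ennreal_suminf_multc suminf_half)
  also have "\<dots> = ennreal (2 * k * t * \<phi> r) * emeasure lebesgue (ball a r)"
    using k t \<phi>[OF r] by (simp only: mult.assoc[symmetric] ennreal_numeral[symmetric]) 
      (simp add: ennreal_mult'[symmetric] mult.assoc del: ennreal_numeral)
  finally show "\<Phi> (ennreal t) * (\<integral>\<^sup>+y\<in>ball a r. g y * indicator {y. g y > ennreal (1 * t)} y \<partial>lebesgue)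
    \<le> ennreal (2 * k * t * \<phi> r) * emeasure lebesgue (ball a r)" .
qed

subsection \<open>The strong estimate\<close>

lemma obtain_powr_layer:
  assumes "k > 1" "s > 0"
  obtains j :: int where "k powr j < s" "s \<le> k powr (j + 1)"
proof -
  \<comment> \<open>Ceiling minus one instead of the floor makes the lower bound strict and the
    upper one weak.\<close>
  let ?j = "\<lceil>log k s\<rceil> - 1"
  have "real_of_int ?j < log k s" by linarith
  then have "k powr ?j < s" using assms by (simp only: less_log_iff)
  moreover have "log k s \<le> real_of_int (?j + 1)" by linarith
  then have "s \<le> k powr (?j + 1)" using assms by (simp only: log_le_iff)
  ultimately show ?thesis by (rule that)
qed

lemma nn_integral_count_space_int_atMost:
  fixes H :: "int \<Rightarrow> ennreal"
  shows "(\<integral>\<^sup>+j\<in>{..J}. H j \<partial>count_space UNIV) = (\<Sum>i. H (J - int i))"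
proof -
  have "inj_on (\<lambda>i. J - int i) UNIV" by (auto simp: inj_on_def)
  moreover have "range (\<lambda>i. J - int i) = {..J}"
  proof (intro equalityI subsetI)
    fix j assume "j \<in> {..J}"
    then have "j = J - int (nat (J - j))" by simp
    then show "j \<in> range (\<lambda>i. J - int i)" by blast
  qed auto
  ultimately have "(\<integral>\<^sup>+j\<in>{..J}. H j \<partial>count_space UNIV) = (\<integral>\<^sup>+i\<in>UNIV. H (J - int i) \<partial>count_space UNIV)"
    using nn_integral_count_compose_inj[of "\<lambda>i. J - int i" UNIV H] by simp
  also have "\<dots> = (\<Sum>i. H (J - int i))"
    by (simp add: nn_integral_count_space_nat)
  finally show ?thesis .
qed

text \<open>The bijection \<open>int_decode\<close> reindexes the integral as a series over the
  natural numbers.\<close>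

lemma borel_measurable_nn_integral_count_space:
  fixes f :: "int \<Rightarrow> 'a \<Rightarrow> ennreal"
  assumes [measurable]: "\<And>j. f j \<in> borel_measurable M"
  shows "(\<lambda>x. \<integral>\<^sup>+j. f j x \<partial>count_space UNIV) \<in> borel_measurable M"
proof -
  have "bij_betw int_decode UNIV UNIV" by (rule bij_int_decode)
  then have "(\<integral>\<^sup>+j. f j x \<partial>count_space UNIV) = (\<Sum>i. f (int_decode i) x)" for x
    by (simp add: nn_integral_bij_count_space[symmetric] nn_integral_count_space_nat)
  then show ?thesis by simp
qed

text \<open>The weight \<open>2 * k powr -j\<close> is the reciprocal of the level k^j / 2, as
  supplied by the weak-type estimate. The truncation removes the levels at or above s. Going i
  levels down from the top one, \<open>\<Phi>\<close> loses (2k)^i while the weight gains only k^i,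
  so the sum is dominated by a multiple of its top term.\<close>

lemma nabla2_layer_sum:
  fixes s :: ennreal
  assumes n: "nabla2_with k \<Phi>" and mono: "mono \<Phi>" and top: "\<Phi> top = top"
  shows "(\<integral>\<^sup>+j. ennreal (2 * k powr - real_of_int j) * \<Phi> (ennreal (k powr real_of_int j / 2)) *
      (s * indicator {ennreal (k powr real_of_int j / 2)<..} s) \<partial>count_space UNIV) \<le> ennreal (2 * k) * \<Phi> s"
    (is "(\<integral>\<^sup>+j. ?F j \<partial>_) \<le> _")
proof -
  have k: "k > 1" using n unfolding nabla2_with_def by simp
  \<comment> \<open>By nabla-2 the layers below \<open>2s\<close> contribute a geometric series of ratio \<open>1/2\<close>.\<close>
  consider "s = 0" | "s = top" | x where "s = ennreal x" "x > 0"
    by (cases s) (auto simp: less_le)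
  then show ?thesis
  proof cases
    case 1
    then show ?thesis by simp
  next
    case 2
    then show ?thesis using top k by simp
  next
    case 3
    \<comment> \<open>\<open>J\<close> is the highest level that survives the truncation, since k^j
      / 2 < x means k^j < 2x.\<close>
    obtain J :: int where J: "k powr J < 2 * x" "2 * x \<le> k powr (J + 1)"
      using obtain_powr_layer[OF k, of "2 * x"] 3 by auto
    define H where "H j = ennreal (k * (1 / 2) ^ nat (J - j)) * \<Phi> s" for j
    have "?F j \<le> H j * indicator {..J} j" for j
    proof (cases "j \<le> J")
      case True
      define i where "i = nat (J - j)"
      have kJ: "k ^ i * (k powr j / 2) = k powr J / 2"
      proof -
        have "k ^ i = k powr real i" using k by (simp add: powr_realpow)
        also have "real i = real_of_int J - real_of_int j" using True by (simp add: i_def)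
        finally have "k ^ i * k powr j = k powr J" by (simp add: powr_add[symmetric])
        then show ?thesis by simp
      qed
      have "\<Phi> (ennreal (k powr j / 2)) \<le> ennreal ((1 / (2 * k)) ^ i) * \<Phi> (ennreal (k ^ i * (k powr j / 2)))"
        using k by (intro nabla2_with_iterate[OF n]) simp
      also have "\<dots> \<le> ennreal ((1 / (2 * k)) ^ i) * \<Phi> s"
        unfolding kJ using J 3 by (intro mult_left_mono monoD[OF mono]) (auto intro!: ennreal_leI)
      finally have \<Phi>: "\<Phi> (ennreal (k powr j / 2)) \<le> ennreal ((1 / (2 * k)) ^ i) * \<Phi> s" .
      \<comment> \<open>Replacing 2x by the upper bound k k^J = k k^i k^j cancels all powers of k
        but one.\<close>
      have c: "2 * k powr - j * (1 / (2 * k)) ^ i * x \<le> k * (1 / 2) ^ i"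
      proof -
        have "2 * x \<le> k * k powr J" using J(2) k by (simp add: powr_add mult.commute)
        also have "k powr J = k ^ i * k powr j" using kJ by simp
        finally have x: "2 * x \<le> k * (k ^ i * k powr j)" .
        have "2 * k powr - j * (1 / (2 * k)) ^ i * x = (k powr - j * (1 / (2 * k)) ^ i) * (2 * x)"
          by simp
        also have "\<dots> \<le> (k powr - j * (1 / (2 * k)) ^ i) * (k * (k ^ i * k powr j))"
          using k by (intro mult_left_mono x) simp
        also have "\<dots> = k * (1 / 2) ^ i * (k powr - j * k powr j)"
          using k by (simp add: field_simps power_mult_distrib)
        also have "k powr - j * k powr j = 1" using k by (simp add: powr_minus)
        finally show ?thesis by simp
      qed
      have "?F j \<le> ennreal (2 * k powr - j) * (ennreal ((1 / (2 * k)) ^ i) * \<Phi> s) * ennreal x"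
        using \<Phi> 3 by (intro mult_mono) (auto simp: indicator_def)
      also have "\<dots> = ennreal (2 * k powr - j) * ennreal ((1 / (2 * k)) ^ i) * ennreal x * \<Phi> s"
        by (simp only: mult_ac)
      also have "ennreal (2 * k powr - j) * ennreal ((1 / (2 * k)) ^ i) * ennreal x
        = ennreal (2 * k powr - j * (1 / (2 * k)) ^ i * x)"
        using k 3 ennreal_mult'[of "2 * k powr - j" "(1 / (2 * k)) ^ i"]
          ennreal_mult'[of "2 * k powr - j * (1 / (2 * k)) ^ i" x] by simp
      also have "\<dots> * \<Phi> s \<le> ennreal (k * (1 / 2) ^ i) * \<Phi> s"
        by (intro mult_right_mono ennreal_leI c) simp
      finally show ?thesis using True by (simp add: H_def i_def)
    next
      case False
      then have "k powr (J + 1) \<le> k powr j" using k by (intro powr_mono) auto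
      then have "x \<le> k powr j / 2" using J by simp
      then have "\<not> ennreal (k powr j / 2) < s" using 3 by (simp add: not_less ennreal_leI)
      then show ?thesis by simp
    qed
    then have "(\<integral>\<^sup>+j. ?F j \<partial>count_space UNIV) \<le> (\<integral>\<^sup>+j\<in>{..J}. H j \<partial>count_space UNIV)"
      by (intro nn_integral_mono)
    also have "\<dots> = (\<Sum>i. H (J - int i))" by (rule nn_integral_count_space_int_atMost)
    also have "\<dots> = (\<Sum>i. ennreal ((1 / 2) ^ i) * (ennreal k * \<Phi> s))"
    proof (rule arg_cong[where f = suminf], rule ext)
      fix i
      have "ennreal (k * (1 / 2) ^ i) = ennreal k * ennreal ((1 / 2) ^ i)"
        using k by (intro ennreal_mult) auto
      then show "H (J - int i) = ennreal ((1 / 2) ^ i) * (ennreal k * \<Phi> s)"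
        by (simp add: H_def mult_ac)
    qed
    also have "\<dots> = 2 * (ennreal k * \<Phi> s)"
      by (simp only: ennreal_suminf_multc suminf_half)
    also have "\<dots> = ennreal (2 * k) * \<Phi> s"
      using k ennreal_mult'[of 2 k] by (simp add: mult.assoc)
    finally show ?thesis .
  qed
qed

text \<open>A \<open>k\<close>-adic substitute for the layer-cake integral of \<open>\<Phi>\<close> composed with the local maximal function.\<close>

definition layer_sum :: "(ennreal \<Rightarrow> ennreal) \<Rightarrow> real \<Rightarrow> ('a::euclidean_space \<Rightarrow> ennreal) \<Rightarrow> 'a \<Rightarrow> real \<Rightarrow> 'a \<Rightarrow> ennreal"
where
  "layer_sum \<Phi> k g a r x = (\<integral>\<^sup>+(j::int). \<Phi> (ennreal (k powr j / 2)) *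
     indicator (local_set g a r (k powr j / 2)) x \<partial>count_space UNIV)"

lemma layer_sum_measurable [measurable]: "layer_sum \<Phi> k g a r \<in> borel_measurable lebesgue"
  unfolding layer_sum_def by (rule borel_measurable_nn_integral_count_space) measurable

text \<open>Tonelli turns the integral into a sum of measures of local sets. After the weak-type
  bound on each of them, Tonelli is used in the other direction, which leaves the pointwise sum of
  \<open>nabla2_layer_sum\<close> under the integral.\<close>

lemma layer_sum_integral:
  fixes g :: "'a::euclidean_space \<Rightarrow> ennreal"
  assumes [measurable]: "g \<in> borel_measurable lebesgue"
    and n: "nabla2_with k \<Phi>" and mono: "mono \<Phi>" and top: "\<Phi> top = top"
  shows "(\<integral>\<^sup>+x. layer_sum \<Phi> k g a r x \<partial>lebesgue) \<le>
    ennreal (5 ^ DIM('a) * (2 * k)) * (\<integral>\<^sup>+y\<in>ball a (2 * r). \<Phi> (g y) \<partial>lebesgue)"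
proof -
  have k: "k > 1" using n unfolding nabla2_with_def by simp
  note tail_measurable[OF assms(1), measurable]
  let ?\<tau> = "\<lambda>j::int. k powr j / 2"
  let ?c = "\<lambda>j::int. ennreal (2 * k powr - j) * \<Phi> (ennreal (?\<tau> j))"
  let ?h = "\<lambda>j y. g y * indicator {y. g y > ennreal (?\<tau> j)} y * indicator (ball a (2 * r)) y"
  have "(\<integral>\<^sup>+x. layer_sum \<Phi> k g a r x \<partial>lebesgue)
    = (\<integral>\<^sup>+(j::int). (\<integral>\<^sup>+x. \<Phi> (ennreal (?\<tau> j)) * indicator (local_set g a r (?\<tau> j)) x \<partial>lebesgue) \<partial>count_space UNIV)"
    unfolding layer_sum_def by (rule nn_integral_count_space_nn_integral) auto
  also have "\<dots> = (\<integral>\<^sup>+(j::int). \<Phi> (ennreal (?\<tau> j)) * emeasure lebesgue (local_set g a r (?\<tau> j)) \<partial>count_space UNIV)"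
    by (intro nn_integral_cong nn_integral_cmult_indicator) measurable
  also have "\<dots> \<le> (\<integral>\<^sup>+(j::int). ennreal (5 ^ DIM('a)) * (\<integral>\<^sup>+y. ?c j * ?h j y \<partial>lebesgue) \<partial>count_space UNIV)"
  proof (rule nn_integral_mono)
    fix j :: int
    have "emeasure lebesgue (local_set g a r (?\<tau> j))
      \<le> ennreal (1 / ?\<tau> j) * (ennreal (5 ^ DIM('a)) * (\<integral>\<^sup>+y. ?h j y \<partial>lebesgue))"
      using k by (intro ennreal_le_cmultI local_set_bound) auto
    also have "1 / ?\<tau> j = 2 * k powr - j" using k by (simp add: powr_minus field_simps)
    finally have "\<Phi> (ennreal (?\<tau> j)) * emeasure lebesgue (local_set g a r (?\<tau> j)) \<le> \<Phi> (ennreal (?\<tau> j)) *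
        (ennreal (2 * k powr - j) * (ennreal (5 ^ DIM('a)) * (\<integral>\<^sup>+y. ?h j y \<partial>lebesgue)))"
      by (intro mult_left_mono) auto
    also have "\<dots> = ennreal (5 ^ DIM('a)) * (?c j * (\<integral>\<^sup>+y. ?h j y \<partial>lebesgue))"
      by (simp only: mult_ac)
    also have "?c j * (\<integral>\<^sup>+y. ?h j y \<partial>lebesgue) = (\<integral>\<^sup>+y. ?c j * ?h j y \<partial>lebesgue)"
      by (rule nn_integral_cmult[symmetric]) measurable
    finally show "\<Phi> (ennreal (?\<tau> j)) * emeasure lebesgue (local_set g a r (?\<tau> j))
      \<le> ennreal (5 ^ DIM('a)) * (\<integral>\<^sup>+y. ?c j * ?h j y \<partial>lebesgue)" .
  qed
  also have "\<dots> = ennreal (5 ^ DIM('a)) * (\<integral>\<^sup>+(j::int). (\<integral>\<^sup>+y. ?c j * ?h j y \<partial>lebesgue) \<partial>count_space UNIV)"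
    by (rule nn_integral_cmult) simp
  also have "(\<integral>\<^sup>+(j::int). (\<integral>\<^sup>+y. ?c j * ?h j y \<partial>lebesgue) \<partial>count_space UNIV)
    = (\<integral>\<^sup>+y. (\<integral>\<^sup>+(j::int). ?c j * ?h j y \<partial>count_space UNIV) \<partial>lebesgue)"
    by (rule nn_integral_count_space_nn_integral[symmetric]) auto
  also have "\<dots> \<le> ennreal (2 * k) * (\<integral>\<^sup>+y\<in>ball a (2 * r). \<Phi> (g y) \<partial>lebesgue)"
  proof (rule nn_integral_le_cmult)
    show "(\<lambda>y. \<integral>\<^sup>+(j::int). ?c j * ?h j y \<partial>count_space UNIV) \<in> borel_measurable lebesgue"
      by (rule borel_measurable_nn_integral_count_space) measurable
    show "2 * k > 0" using k by simp
    fix y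
    show "(\<integral>\<^sup>+(j::int). ?c j * ?h j y \<partial>count_space UNIV)
      \<le> ennreal (2 * k) * (\<Phi> (g y) * indicator (ball a (2 * r)) y)"
      using nabla2_layer_sum[OF n mono top, of "g y"] by (simp add: indicator_def)
  qed
  finally show ?thesis
    using k by (simp add: ennreal_mult mult.assoc mult_left_mono)
qed

text \<open>Rounding the maximal function down to a power of k costs the factor k, and matching that
  power with the level 2 A T of \<open>maxfun_local_or_small\<close> costs 2A. If a small ball
  detects the point, one layer alone dominates; otherwise \<open>K * \<phi> r\<close> does.\<close>

lemma maxfun_le_layer_sum:
  fixes a :: "'a::euclidean_space"
  assumes [measurable]: "g \<in> borel_measurable lebesgue"
    and tb: "tail_bound \<Phi> \<phi> A A g" and q: "quasi_convex A \<Phi>" "A \<ge> 1" "a_of \<Phi> < \<infinity>"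
    and mono: "mono \<Phi>" and zero: "\<Phi> 0 = 0" and k: "k > 1" and "r > 0"
    and K: "\<And>r s. 0 < r \<Longrightarrow> r / 2 < s \<Longrightarrow> \<phi> s \<le> K * \<phi> r"
    and x: "x \<in> ball a r"
  shows "\<Phi> (maxfun g x / ennreal (2 * A * k)) \<le> layer_sum \<Phi> k g a r x + ennreal (K * \<phi> r)"
    (is "_ \<le> ?R")
proof -
  have layer: "\<Phi> (ennreal (k powr j / (2 * A))) \<le> ?R" if "ennreal (k powr j) < maxfun g x" for j :: int
  proof -
    \<comment> \<open>T = k^j / (2A) is chosen so that the local set has level k^j / 2, as in
      \<open>layer_sum\<close>.\<close>
    have c: "A * (k powr j / (2 * A)) = k powr j / 2" using q by simp
    have "x \<in> local_set g a r (A * (k powr j / (2 * A))) \<or> \<Phi> (ennreal (k powr j / (2 * A))) \<le> ennreal (K * A / A * \<phi> r)"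
      using q k \<open>r > 0\<close> x that by (intro maxfun_local_or_small[OF assms(1) tb _ _ _ _ K]) (auto simp: c)
    then consider "x \<in> local_set g a r (k powr j / 2)" | "\<Phi> (ennreal (k powr j / (2 * A))) \<le> ennreal (K * \<phi> r)"
      using q(2) unfolding c by auto
    then show ?thesis
    proof cases
      case 1
      have "k powr j / (2 * A) \<le> k powr j / 2" using q k by (intro divide_left_mono) auto
      then have "\<Phi> (ennreal (k powr j / (2 * A))) \<le> \<Phi> (ennreal (k powr j / 2))"
        by (intro monoD[OF mono] ennreal_leI)
      also have "\<dots> = \<Phi> (ennreal (k powr j / 2)) * indicator (local_set g a r (k powr j / 2)) x"
        using 1 by simp
      also have "\<dots> \<le> layer_sum \<Phi> k g a r x"
        unfolding layer_sum_def by (rule nn_integral_ge_point) simp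
      finally show ?thesis by (rule order_trans) simp
    next
      case 2
      then show ?thesis by (rule order_trans) simp
    qed
  qed
  consider "maxfun g x = 0" | "maxfun g x = top" | u where "maxfun g x = ennreal u" "u > 0"
    by (cases "maxfun g x") (auto simp: less_le)
  then show ?thesis
  proof cases
    case 1
    then show ?thesis using zero by simp
  next
    case 2
    \<comment> \<open>An infinite value exceeds every level, so \<open>layer\<close> is available at
      arbitrarily large j, where \<open>\<Phi>\<close> is unbounded.\<close>
    have "?R = top"
    proof (rule ennreal_topI)
      fix M :: real assume "M \<ge> 0"
      then obtain T where T: "T > 0" "ennreal M < \<Phi> (ennreal T)"
        using quasi_convex_unbounded[OF q] by blast
      have "2 * A * T > 0" using T q by simp
      then obtain j :: int where j: "2 * A * T \<le> k powr (j + 1)"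
        using obtain_powr_layer[OF k] by metis
      then have "T \<le> k powr (j + 1) / (2 * A)" using q by (simp add: field_simps)
      then have "\<Phi> (ennreal T) \<le> \<Phi> (ennreal (k powr (j + 1) / (2 * A)))"
        by (intro monoD[OF mono] ennreal_leI)
      also have "\<dots> \<le> ?R" using layer[of "j + 1"] 2 by simp
      finally show "ennreal M \<le> ?R" using T by simp
    qed
    then show ?thesis by simp
  next
    case 3
    obtain j :: int where j: "k powr j < u" "u \<le> k powr (j + 1)"
      using obtain_powr_layer[OF k 3(2)] by blast
    have "u / (2 * A * k) \<le> k powr (j + 1) / (2 * A * k)"
      using j q k by (intro divide_right_mono) auto
    also have "\<dots> = k powr j / (2 * A)" using k by (simp add: powr_add)
    finally have "\<Phi> (ennreal (u / (2 * A * k))) \<le> \<Phi> (ennreal (k powr j / (2 * A)))"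
      by (intro monoD[OF mono] ennreal_leI)
    also have "\<dots> \<le> ?R" using j 3 by (intro layer) (simp add: ennreal_less_iff)
    finally show ?thesis using 3 q k by (simp add: divide_ennreal)
  qed
qed

text \<open>\<open>D\<close> collects 5^n 2k from the layers, 2^n K from the doubled ball, and one
  further K from the large balls. Dividing the argument by \<open>A * D\<close> absorbs it by
  quasi-convexity.\<close>

lemma maxfun_strong_bound:
  fixes g :: "'a::euclidean_space \<Rightarrow> ennreal"
  assumes [measurable]: "g \<in> borel_measurable lebesgue"
    and n: "nabla2_with k \<Phi>" and q: "quasi_convex A \<Phi>" "A \<ge> 1" "a_of \<Phi> < \<infinity>"
    and mono: "mono \<Phi>" and zero: "\<Phi> 0 = 0" and "r > 0" and "K > 0"
    and \<phi>: "\<And>r. r > 0 \<Longrightarrow> \<phi> r > 0"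
    and K: "\<And>r s. 0 < r \<Longrightarrow> r / 2 < s \<Longrightarrow> \<phi> s \<le> K * \<phi> r"
    and bd: "\<And>a r. r > 0 \<Longrightarrow> (\<integral>\<^sup>+y\<in>ball a r. \<Phi> (g y) \<partial>lebesgue) \<le> ennreal (\<phi> r) * emeasure lebesgue (ball a r)"
    and D: "D \<ge> (10 ^ DIM('a) * (2 * k) + 1) * K" "D \<ge> 1"
  shows "(\<integral>\<^sup>+x\<in>ball a r. \<Phi> (maxfun g x / ennreal (2 * A * k) / ennreal (A * D)) \<partial>lebesgue)
    \<le> ennreal (\<phi> r) * emeasure lebesgue (ball a r)"
proof -
  have k: "k > 1" using n unfolding nabla2_with_def by simp
  have top: "\<Phi> top = top" by (rule quasi_convex_top[OF q mono])
  have tb: "tail_bound \<Phi> \<phi> A A g"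
    by (rule tail_bound_strong[OF assms(1) q(1,2) top bd])
  let ?m = "emeasure lebesgue (ball a r)"
  let ?S = "\<lambda>x. layer_sum \<Phi> k g a r x"
  have pw: "\<Phi> (s / ennreal (A * D)) \<le> ennreal (1 / D) * \<Phi> s" for s
  proof -
    have "A * D > 0" using q D by simp
    then have "ennreal (A * D) \<noteq> 0" by (metis ennreal_eq_0_iff not_le)
    then have "ennreal (A * D) * (s / ennreal (A * D)) = s"
      by (simp add: ennreal_times_divide mult.commute[of "ennreal (A * D)"] mult_divide_eq_ennreal)
    then show ?thesis
      using quasi_convex_divide[OF q(1,2) D(2), of "s / ennreal (A * D)"] by simp
  qed
  \<comment> \<open>The layer sum is integrated over the whole space, because the local sets may
    leave the ball; the constant term must keep its indicator.\<close>
  have "(\<integral>\<^sup>+x\<in>ball a r. \<Phi> (maxfun g x / ennreal (2 * A * k) / ennreal (A * D)) \<partial>lebesgue)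
    \<le> (\<integral>\<^sup>+x. ennreal (1 / D) * (?S x + ennreal (K * \<phi> r) * indicator (ball a r) x) \<partial>lebesgue)"
  proof (rule nn_integral_mono)
    fix x
    show "\<Phi> (maxfun g x / ennreal (2 * A * k) / ennreal (A * D)) * indicator (ball a r) x
      \<le> ennreal (1 / D) * (?S x + ennreal (K * \<phi> r) * indicator (ball a r) x)"
    proof (cases "x \<in> ball a r")
      case True
      have "\<Phi> (maxfun g x / ennreal (2 * A * k) / ennreal (A * D))
        \<le> ennreal (1 / D) * \<Phi> (maxfun g x / ennreal (2 * A * k))" by (rule pw)
      also have "\<dots> \<le> ennreal (1 / D) * (?S x + ennreal (K * \<phi> r))"
        using maxfun_le_layer_sum[OF assms(1) tb q mono zero k \<open>r > 0\<close> K True]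
        by (intro mult_left_mono) auto
      finally show ?thesis using True by simp
    qed simp
  qed
  also have "\<dots> = ennreal (1 / D) * ((\<integral>\<^sup>+x. ?S x \<partial>lebesgue) + ennreal (K * \<phi> r) * ?m)"
    by (simp add: nn_integral_cmult nn_integral_add nn_integral_cmult_indicator del: emeasure_completion)
  also have "(\<integral>\<^sup>+x. ?S x \<partial>lebesgue) \<le> ennreal (10 ^ DIM('a) * (2 * k) * K * \<phi> r) * ?m"
  proof -
    have "(\<integral>\<^sup>+x. ?S x \<partial>lebesgue) \<le>
      ennreal (5 ^ DIM('a) * (2 * k)) * (\<integral>\<^sup>+y\<in>ball a (2 * r). \<Phi> (g y) \<partial>lebesgue)"
      by (rule layer_sum_integral[OF assms(1) n mono top])
    also have "\<dots> \<le> ennreal (5 ^ DIM('a) * (2 * k)) * (ennreal (\<phi> (2 * r)) * emeasure lebesgue (ball a (2 * r)))"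
      using \<open>r > 0\<close> by (intro mult_left_mono bd) auto
    also have "\<dots> \<le> ennreal (5 ^ DIM('a) * (2 * k)) * (ennreal (K * \<phi> r) * emeasure lebesgue (ball a (2 * r)))"
      using \<open>r > 0\<close> by (intro mult_left_mono mult_right_mono ennreal_leI K) auto
    also have "emeasure lebesgue (ball a (2 * r)) = ennreal (2 ^ DIM('a)) * ?m"
      using emeasure_ball_scale[of r 2 a a] \<open>r > 0\<close> by simp
    also have "ennreal (5 ^ DIM('a) * (2 * k)) * (ennreal (K * \<phi> r) * (ennreal (2 ^ DIM('a)) * ?m))
      = (ennreal (5 ^ DIM('a) * (2 * k)) * (ennreal (K * \<phi> r) * ennreal (2 ^ DIM('a)))) * ?m"
      by (simp only: mult.assoc)
    also have "ennreal (5 ^ DIM('a) * (2 * k)) * (ennreal (K * \<phi> r) * ennreal (2 ^ DIM('a)))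
      = ennreal (5 ^ DIM('a) * (2 * k) * (K * \<phi> r * 2 ^ DIM('a)))"
      using k \<open>K > 0\<close> \<phi>[OF \<open>r > 0\<close>] by (simp only: ennreal_mult''[symmetric] zero_le_power zero_le_numeral) (rule ennreal_mult'[symmetric], simp)
    also have "5 ^ DIM('a) * (2 * k) * (K * \<phi> r * 2 ^ DIM('a)) = (5 * 2) ^ DIM('a) * (2 * k) * K * \<phi> r"
      unfolding power_mult_distrib by (simp only: mult_ac)
    finally show ?thesis by simp
  qed
  also have "ennreal (10 ^ DIM('a) * (2 * k) * K * \<phi> r) * ?m + ennreal (K * \<phi> r) * ?m
    = ennreal ((10 ^ DIM('a) * (2 * k) + 1) * K * \<phi> r) * ?m"
    using k \<open>K > 0\<close> \<phi>[OF \<open>r > 0\<close>]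
      ennreal_plus[of "10 ^ DIM('a) * (2 * k) * K * \<phi> r" "K * \<phi> r"]
    by (simp add: distrib_right[symmetric] algebra_simps del: ennreal_plus emeasure_completion)
  also have "\<dots> \<le> ennreal (D * \<phi> r) * ?m"
    using D \<phi>[OF \<open>r > 0\<close>] by (intro mult_right_mono ennreal_leI) auto
  also have "ennreal (1 / D) * (ennreal (D * \<phi> r) * ?m) = ennreal (\<phi> r) * ?m"
    using D by (simp add: mult.assoc[symmetric] ennreal_mult'[symmetric])
  finally show ?thesis by (simp add: mult_left_mono)
qed

subsection \<open>Norms\<close>

lemma ennreal_divide_mult:
  assumes "p > 0" "q > 0"
  shows "x / ennreal (p * q) = x / ennreal p / ennreal q"
  using assms by (simp add: divide_ennreal_def ennreal_inverse_mult ennreal_mult' mult.assoc)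

lemma ennreal_divide_left_antimono:
  assumes "0 < p" "p \<le> q"
  shows "x / ennreal q \<le> x / ennreal p"
  using assms unfolding divide_ennreal_def
  by (intro mult_left_mono) (auto simp: inverse_ennreal intro!: ennreal_leI)

lemma ennreal_divide_le_1_iff:
  fixes x c :: ennreal
  assumes "c \<noteq> 0" "c \<noteq> top"
  shows "x / c \<le> 1 \<longleftrightarrow> x \<le> c"
proof
  assume "x / c \<le> 1"
  then have "x / c * c \<le> 1 * c" by (rule mult_right_mono) simp
  moreover have "x / c * c = x"
    using assms ennreal_divide_self[of c] by (simp only: ennreal_divide_times top.not_eq_extremum mult_1_right simp_thms)
  ultimately show "x \<le> c" by simp
next
  assume "x \<le> c"
  then have "x / c \<le> c / c" by (rule divide_right_mono_ennreal)
  then show "x / c \<le> 1" using assms ennreal_divide_self[of c] by (simp add: top.not_eq_extremum)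
qed

lemma less_divide_ennrealD:
  assumes "c > 0" "t \<ge> 0" "ennreal t < x / ennreal c"
  shows "ennreal (c * t) < x"
proof (rule ccontr)
  assume "\<not> ennreal (c * t) < x"
  then have "x / ennreal c \<le> ennreal (c * t) / ennreal c"
    by (intro divide_right_mono_ennreal) simp
  also have "\<dots> = ennreal t" using assms by (simp add: divide_ennreal)
  finally show False using assms by simp
qed

lemma eabs_measurable [measurable]:
  assumes [measurable]: "f \<in> borel_measurable M"
  shows "(\<lambda>x. eabs (f x)) \<in> borel_measurable M"
  unfolding eabs_def by measurable

lemma eabs_enn2ereal [simp]: "eabs (enn2ereal x) = x"
  by (simp add: eabs_def)

lemma eabs_divide:
  assumes "\<mu> > 0"
  shows "eabs (y / ereal \<mu>) = eabs y / ennreal \<mu>"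
proof (cases y)
  case (real r)
  then show ?thesis using assms
    by (simp add: eabs_def divide_ennreal e2ennreal_ereal abs_divide)
qed (use assms in \<open>auto simp: eabs_def ennreal_top_divide\<close>)

lemma HL_maximal_maxfun: "HL_maximal f x = enn2ereal (maxfun (\<lambda>y. eabs (f y)) x)"
  unfolding HL_maximal_def maxfun_def ..

lemma HL_maximal_measurable: "HL_maximal f \<in> borel_measurable lebesgue"
  unfolding HL_maximal_maxfun[abs_def] by measurable

lemma eabs_HL_maximal_scale:
  assumes "f \<in> borel_measurable lebesgue" "C > 0" "\<mu> > 0"
  shows "eabs (HL_maximal f x) / ennreal (C * \<mu>) = maxfun (\<lambda>y. eabs (f y) / ennreal \<mu>) x / ennreal C"
  using assms by (simp add: HL_maximal_maxfun maxfun_scale ennreal_divide_mult mult.commute[of C])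

lemma ball_weight:
  assumes "r > 0" "\<phi> r > 0"
  shows "ennreal (\<phi> r) * emeasure lebesgue (ball a r) \<noteq> 0"
    "ennreal (\<phi> r) * emeasure lebesgue (ball a r) \<noteq> top"
  using assms emeasure_ball_pos_finite[of r a] by (auto simp: ennreal_mult_eq_top_iff simp del: emeasure_completion)

text \<open>The strict inequality provides an admissible \<open>\<nu> < \<mu>\<close> on each ball,
  and monotonicity of \<open>\<Phi>\<close> passes to \<open>\<mu>\<close>, whether or not the
  infimum is attained.\<close>

lemma OM_norm_lessD:
  fixes f :: "'a::euclidean_space \<Rightarrow> ereal"
  assumes less: "OM_norm \<Phi> \<phi> f < ennreal \<mu>" and mono: "mono \<Phi>" and "r > 0" "\<phi> r > 0"
  shows "(\<integral>\<^sup>+x\<in>ball a r. \<Phi> (eabs (f x) / ennreal \<mu>) \<partial>lebesgue) \<le> ennreal (\<phi> r) * emeasure lebesgue (ball a r)"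
proof -
  have "ball_norm \<Phi> \<phi> a r f \<le> OM_norm \<Phi> \<phi> f"
    unfolding OM_norm_def using \<open>r > 0\<close> by (intro SUP_upper2[of "(a, r)"]) auto
  with less have "ball_norm \<Phi> \<phi> a r f < ennreal \<mu>" by (rule le_less_trans[rotated])
  then obtain \<nu> where \<nu>: "\<nu> > 0" "ennreal \<nu> < ennreal \<mu>"
    and le: "(\<integral>\<^sup>+x\<in>ball a r. \<Phi> (eabs (f x) / ennreal \<nu>) \<partial>lebesgue)
        / (ennreal (\<phi> r) * emeasure lebesgue (ball a r)) \<le> 1"
    unfolding ball_norm_def Inf_less_iff by auto
  have "eabs (f x) / ennreal \<mu> \<le> eabs (f x) / ennreal \<nu>" for x
    using \<nu> by (intro ennreal_divide_left_antimono) (auto simp: ennreal_less_iff)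
  then have "(\<integral>\<^sup>+x\<in>ball a r. \<Phi> (eabs (f x) / ennreal \<mu>) \<partial>lebesgue)
    \<le> (\<integral>\<^sup>+x\<in>ball a r. \<Phi> (eabs (f x) / ennreal \<nu>) \<partial>lebesgue)"
    by (intro nn_integral_mono mult_right_mono monoD[OF mono]) auto
  also have "\<dots> \<le> ennreal (\<phi> r) * emeasure lebesgue (ball a r)"
    using le by (simp only: ennreal_divide_le_1_iff[OF ball_weight[of r \<phi> a, OF assms(3,4)]])
  finally show ?thesis .
qed

lemma OM_norm_leI:
  fixes f :: "'a::euclidean_space \<Rightarrow> ereal"
  assumes "\<mu> > 0" and \<phi>: "\<And>r. r > 0 \<Longrightarrow> \<phi> r > 0"
    and bd: "\<And>a r. r > 0 \<Longrightarrow>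
      (\<integral>\<^sup>+x\<in>ball a r. \<Phi> (eabs (f x) / ennreal \<mu>) \<partial>lebesgue) \<le> ennreal (\<phi> r) * emeasure lebesgue (ball a r)"
  shows "OM_norm \<Phi> \<phi> f \<le> ennreal \<mu>"
  unfolding OM_norm_def
proof (rule SUP_least)
  fix p :: "'a \<times> real" assume "p \<in> UNIV \<times> {0<..}"
  then obtain a r where p: "p = (a, r)" and r: "r > 0" by auto
  have "ball_norm \<Phi> \<phi> a r f \<le> ennreal \<mu>"
  proof -
    have "(\<integral>\<^sup>+x\<in>ball a r. \<Phi> (eabs (f x) / ennreal \<mu>) \<partial>lebesgue)
        / (ennreal (\<phi> r) * emeasure lebesgue (ball a r)) \<le> 1"
      using bd[OF r] by (simp only: ennreal_divide_le_1_iff[OF ball_weight[of r \<phi> a, OF r \<phi>[OF r]]])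
    then show ?thesis unfolding ball_norm_def using \<open>\<mu> > 0\<close> by (intro Inf_lower) blast
  qed
  then show "(case p of (a, r) \<Rightarrow> ball_norm \<Phi> \<phi> a r f) \<le> ennreal \<mu>" by (simp add: p)
qed

lemma wOM_norm_lessD:
  fixes f :: "'a::euclidean_space \<Rightarrow> ereal"
  assumes f [measurable]: "f \<in> borel_measurable lebesgue"
    and less: "wOM_norm \<Phi> \<phi> f < ennreal \<mu>" and "r > 0" "\<phi> r > 0" "t > 0"
  shows "\<Phi> (ennreal t) * emeasure lebesgue {x \<in> ball a r. eabs (f x) / ennreal \<mu> > ennreal t}
    \<le> ennreal (\<phi> r) * emeasure lebesgue (ball a r)"
proof -
  have "ball_norm_weak \<Phi> \<phi> a r f \<le> wOM_norm \<Phi> \<phi> f"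
    unfolding wOM_norm_def using \<open>r > 0\<close> by (intro SUP_upper2[of "(a, r)"]) auto
  with less have "ball_norm_weak \<Phi> \<phi> a r f < ennreal \<mu>" by (rule le_less_trans[rotated])
  then obtain \<nu> where \<nu>: "\<nu> > 0" "ennreal \<nu> < ennreal \<mu>"
    and le: "(SUP t\<in>{0<..<\<infinity>}. \<Phi> t * distr_fun (ball a r) (\<lambda>x. f x / ereal \<nu>) t
        / (emeasure lebesgue (ball a r) * ennreal (\<phi> r))) \<le> 1"
    unfolding ball_norm_weak_def Inf_less_iff by auto
  have "ennreal t \<in> {0<..<\<infinity>}" using \<open>t > 0\<close> by simp
  then have "\<Phi> (ennreal t) * distr_fun (ball a r) (\<lambda>x. f x / ereal \<nu>) (ennreal t)
        / (ennreal (\<phi> r) * emeasure lebesgue (ball a r)) \<le> 1"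
    using le unfolding SUP_le_iff mult.commute[of "ennreal (\<phi> r)"] by blast
  then have *: "\<Phi> (ennreal t) * distr_fun (ball a r) (\<lambda>x. f x / ereal \<nu>) (ennreal t)
      \<le> ennreal (\<phi> r) * emeasure lebesgue (ball a r)"
    by (simp only: ennreal_divide_le_1_iff[OF ball_weight[of r \<phi> a, OF assms(3,4)]])
  have "eabs (f x) / ennreal \<mu> \<le> eabs (f x) / ennreal \<nu>" for x
    using \<nu> by (intro ennreal_divide_left_antimono) (auto simp: ennreal_less_iff)
  then have "{x \<in> ball a r. eabs (f x) / ennreal \<mu> > ennreal t} \<subseteq> {x \<in> ball a r. eabs (f x) / ennreal \<nu> > ennreal t}"
    using less_le_trans by blast
  then have "emeasure lebesgue {x \<in> ball a r. eabs (f x) / ennreal \<mu> > ennreal t}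
    \<le> distr_fun (ball a r) (\<lambda>x. f x / ereal \<nu>) (ennreal t)"
    unfolding distr_fun_def eabs_divide[OF \<nu>(1)] by (intro emeasure_mono) measurable
  then show ?thesis using * by (meson mult_left_mono order_trans zero_le)
qed

lemma wOM_norm_leI:
  fixes f :: "'a::euclidean_space \<Rightarrow> ereal"
  assumes "\<mu> > 0" and \<phi>: "\<And>r. r > 0 \<Longrightarrow> \<phi> r > 0"
    and bd: "\<And>a r t. r > 0 \<Longrightarrow> t > 0 \<Longrightarrow>
      \<Phi> (ennreal t) * emeasure lebesgue {x \<in> ball a r. eabs (f x) / ennreal \<mu> > ennreal t}
        \<le> ennreal (\<phi> r) * emeasure lebesgue (ball a r)"
  shows "wOM_norm \<Phi> \<phi> f \<le> ennreal \<mu>"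
  unfolding wOM_norm_def
proof (rule SUP_least)
  fix p :: "'a \<times> real" assume "p \<in> UNIV \<times> {0<..}"
  then obtain a r where p: "p = (a, r)" and r: "r > 0" by auto
  have "ball_norm_weak \<Phi> \<phi> a r f \<le> ennreal \<mu>"
  proof -
    have "(SUP t\<in>{0<..<\<infinity>}. \<Phi> t * distr_fun (ball a r) (\<lambda>x. f x / ereal \<mu>) t
        / (emeasure lebesgue (ball a r) * ennreal (\<phi> r))) \<le> 1"
    proof (rule SUP_least)
      fix t :: ennreal assume "t \<in> {0<..<\<infinity>}"
      then obtain u where u: "t = ennreal u" "u > 0" by (cases t) auto
      show "\<Phi> t * distr_fun (ball a r) (\<lambda>x. f x / ereal \<mu>) t
        / (emeasure lebesgue (ball a r) * ennreal (\<phi> r)) \<le> 1"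
        unfolding mult.commute[of _ "ennreal (\<phi> r)"] ennreal_divide_le_1_iff[OF ball_weight[of r \<phi> a, OF r \<phi>[OF r]]]
          distr_fun_def eabs_divide[OF \<open>\<mu> > 0\<close>] u(1)
        by (rule bd[OF r u(2)])
    qed
    then show ?thesis unfolding ball_norm_weak_def using \<open>\<mu> > 0\<close> by (intro Inf_lower) blast
  qed
  then show "(case p of (a, r) \<Rightarrow> ball_norm_weak \<Phi> \<phi> a r f) \<le> ennreal \<mu>" by (simp add: p)
qed

text \<open>Modular inequalities are at hand only for parameters strictly above the norm. Letting
  these decrease to the norm gives the bound, also when the norm is 0.\<close>

lemma bounded_operatorI:
  assumes "C > (0::real)"
    and le: "\<And>f \<mu>. f \<in> X \<Longrightarrow> \<mu> > 0 \<Longrightarrow> normX f < ennreal \<mu> \<Longrightarrow> normY (T f) \<le> ennreal (C * \<mu>)"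
    and fin: "\<And>f. f \<in> X \<Longrightarrow> normX f < \<infinity>"
    and Y: "\<And>f. f \<in> X \<Longrightarrow> normY (T f) < \<infinity> \<Longrightarrow> T f \<in> Y"
  shows "bounded_operator T X normX Y normY"
  unfolding bounded_operator_def
proof (intro exI conjI ballI)
  fix f assume f: "f \<in> X"
  obtain p where p: "normX f = ennreal p" "p \<ge> 0" using fin[OF f] by (cases "normX f") auto
  have *: "normY (T f) \<le> ennreal (C * (p + e))" if "e > 0" for e
    using that p by (intro le f) (auto simp: ennreal_less_iff)
  show "T f \<in> Y" using *[of 1] by (intro Y f) (auto intro: le_less_trans)
  have "normY (T f) \<le> ennreal (C * p)"
  proof (rule ennreal_le_epsilon)
    fix e :: real assume "e > 0"
    then have "normY (T f) \<le> ennreal (C * (p + e / C))" using \<open>C > 0\<close> by (intro *) simp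
    also have "C * (p + e / C) = C * p + e" using \<open>C > 0\<close> by (simp add: field_simps)
    also have "ennreal (C * p + e) = ennreal (C * p) + ennreal e"
      using \<open>C > 0\<close> p \<open>e > 0\<close> by (intro ennreal_plus) auto
    finally show "normY (T f) \<le> ennreal (C * p) + ennreal e" .
  qed
  then show "normY (T f) \<le> ennreal C * normX f" using \<open>C > 0\<close> p by (simp add: ennreal_mult')
qed fact

section \<open>Comparison of weights at comparable radii, and the operator bounds\<close>

lemma G_dec_doubling:
  assumes "\<phi> \<in> G_dec n"
  obtains K where "K > 0" "\<And>r s. 0 < r \<Longrightarrow> r / 2 < s \<Longrightarrow> \<phi> s \<le> K * \<phi> r"
proof -
  from assms obtain C where pos: "\<And>r. r > 0 \<Longrightarrow> \<phi> r > 0" and "C > 0"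
    and up: "\<And>r s. 0 < r \<Longrightarrow> r < s \<Longrightarrow> \<phi> s \<le> C * \<phi> r"
    and down: "\<And>r s. 0 < r \<Longrightarrow> r < s \<Longrightarrow> \<phi> r * r ^ n \<le> C * (\<phi> s * s ^ n)"
    unfolding G_dec_def by auto
  let ?K = "max 1 (C * 2 ^ n)"
  have "\<phi> s \<le> ?K * \<phi> r" if r: "0 < r" "r / 2 < s" for r s
  proof -
    have \<phi>: "\<phi> r > 0" "\<phi> s > 0" using r by (auto intro: pos)
    consider "s < r" | "s = r" | "r < s" by linarith
    then show ?thesis
    proof cases
      case 1
      \<comment> \<open>For a slightly smaller radius only the almost increase of
        \<open>\<phi> r * r ^ n\<close> helps; r < 2s turns it into a bound on \<open>\<phi>\<close>
        at the price of 2^n.\<close>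
      have "\<phi> s * s ^ n \<le> C * (\<phi> r * r ^ n)" using r 1 by (intro down) auto
      also have "r ^ n \<le> (2 * s) ^ n" using r by (intro power_mono) auto
      then have "C * (\<phi> r * r ^ n) \<le> C * (\<phi> r * (2 * s) ^ n)"
        using \<open>C > 0\<close> \<phi> by (intro mult_left_mono) auto
      also have "\<dots> = (C * 2 ^ n * \<phi> r) * s ^ n" by (simp add: power_mult_distrib)
      finally have "\<phi> s \<le> C * 2 ^ n * \<phi> r" using r by simp
      also have "\<dots> \<le> ?K * \<phi> r" using \<phi> by (intro mult_right_mono) auto
      finally show ?thesis .
    next
      case 2
      have "1 * \<phi> r \<le> ?K * \<phi> r" using \<phi> by (intro mult_right_mono) auto
      then show ?thesis using 2 by simp
    next
      case 3
      have "C * 1 \<le> C * 2 ^ n" using \<open>C > 0\<close> by (intro mult_left_mono) auto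
      then have "C * \<phi> r \<le> ?K * \<phi> r" using \<phi> by (intro mult_right_mono) auto
      then show ?thesis using up[of r s] r 3 by simp
    qed
  qed
  then show ?thesis by (intro that[of ?K]) auto
qed

text \<open>The factor 2c comes from the level in \<open>maxfun_weak_bound\<close>, and A E from
  absorbing its constant, which E dominates, into the argument of \<open>\<Phi>\<close>.\<close>

lemma HL_maximal_weak_norm:
  fixes f :: "'a::euclidean_space \<Rightarrow> ereal"
  assumes f [measurable]: "f \<in> borel_measurable lebesgue" and "\<mu> > 0"
    and tb: "tail_bound \<Phi> \<phi> c D (\<lambda>x. eabs (f x) / ennreal \<mu>)" and pos: "c > 0" "D > 0" "K > 0"
    and q: "quasi_convex A \<Phi>" "A \<ge> 1" and \<phi>: "\<And>r. r > 0 \<Longrightarrow> \<phi> r > 0"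
    and K: "\<And>r s. 0 < r \<Longrightarrow> r / 2 < s \<Longrightarrow> \<phi> s \<le> K * \<phi> r"
    and E: "E \<ge> 1" "E \<ge> 10 ^ DIM('a) * (K * D / c)"
  shows "wOM_norm \<Phi> \<phi> (HL_maximal f) \<le> ennreal (2 * c * A * E * \<mu>)"
proof (rule wOM_norm_leI)
  have C: "2 * c * A * E > 0" using pos q E by simp
  then show "2 * c * A * E * \<mu> > 0" using \<open>\<mu> > 0\<close> by simp
  fix a :: 'a and r t :: real assume r: "r > 0" and t: "t > 0"
  let ?g = "\<lambda>x. eabs (f x) / ennreal \<mu>"
  \<comment> \<open>At this T the level 2 c T is exactly the norm constant times t, and
    \<open>\<Phi>\<close> at t is at most 1/E times \<open>\<Phi>\<close> at T.\<close>
  let ?T = "A * E * t"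
  let ?S = "{x \<in> ball a r. ennreal (2 * (c * ?T)) < maxfun ?g x}"
  have T: "?T > 0" using q E t by simp
  have S: "?S \<in> sets lebesgue" by measurable
  have "{x \<in> ball a r. eabs (HL_maximal f x) / ennreal (2 * c * A * E * \<mu>) > ennreal t} \<subseteq> ?S"
  proof (intro subsetI CollectI conjI)
    fix x assume x: "x \<in> {x \<in> ball a r. eabs (HL_maximal f x) / ennreal (2 * c * A * E * \<mu>) > ennreal t}"
    then show "x \<in> ball a r" by simp
    have "ennreal t < maxfun ?g x / ennreal (2 * c * A * E)"
      using x unfolding eabs_HL_maximal_scale[OF f C \<open>\<mu> > 0\<close>] by simp
    then have "ennreal (2 * c * A * E * t) < maxfun ?g x"
      using C t by (intro less_divide_ennrealD) auto
    then show "ennreal (2 * (c * ?T)) < maxfun ?g x" by (simp only: mult.assoc)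
  qed
  then have "emeasure lebesgue {x \<in> ball a r. eabs (HL_maximal f x) / ennreal (2 * c * A * E * \<mu>) > ennreal t}
      \<le> emeasure lebesgue ?S"
    by (rule emeasure_mono) (rule S)
  moreover have "ennreal (A * E) * ennreal t = ennreal ?T"
    using q E by (intro ennreal_mult'[symmetric]) simp
  then have "\<Phi> (ennreal t) \<le> ennreal (1 / E) * \<Phi> (ennreal ?T)"
    using quasi_convex_divide[OF q E(1), of "ennreal t"] by simp
  ultimately have "\<Phi> (ennreal t) * emeasure lebesgue {x \<in> ball a r. eabs (HL_maximal f x) / ennreal (2 * c * A * E * \<mu>) > ennreal t}
    \<le> (ennreal (1 / E) * \<Phi> (ennreal ?T)) * emeasure lebesgue ?S"
    by (intro mult_mono zero_le)
  also have "\<dots> \<le> ennreal (1 / E) * (ennreal (10 ^ DIM('a) * (K * D / c) * \<phi> r) * emeasure lebesgue (ball a r))"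
    unfolding mult.assoc[of "ennreal (1 / E)"]
    using T r \<phi> by (intro mult_left_mono maxfun_weak_bound[OF _ tb pos(1,2) _ _ pos(3) _ K]) auto
  also have "\<dots> \<le> ennreal (1 / E) * (ennreal (E * \<phi> r) * emeasure lebesgue (ball a r))"
    using E \<phi>[OF r] by (intro mult_left_mono mult_right_mono ennreal_leI) auto
  also have "\<dots> = ennreal (\<phi> r) * emeasure lebesgue (ball a r)"
    using E by (simp add: mult.assoc[symmetric] ennreal_mult'[symmetric])
  finally show "\<Phi> (ennreal t) * emeasure lebesgue {x \<in> ball a r. eabs (HL_maximal f x) / ennreal (2 * c * A * E * \<mu>) > ennreal t}
    \<le> ennreal (\<phi> r) * emeasure lebesgue (ball a r)" .
qed (rule \<phi>)

theorem HL_maximal_bounded: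
  fixes \<Phi> :: "ennreal \<Rightarrow> ennreal" and \<phi> :: "real \<Rightarrow> real"
  assumes \<Phi>: "\<Phi> \<in> Phi_bar_Y" and \<phi>G: "\<phi> \<in> G_dec DIM('a::euclidean_space)"
  shows HL_maximal_OM_wOM: "bounded_operator (HL_maximal :: ('a \<Rightarrow> ereal) \<Rightarrow> 'a \<Rightarrow> ereal)
      (OM_space \<Phi> \<phi>) (OM_norm \<Phi> \<phi>) (wOM_space \<Phi> \<phi>) (wOM_norm \<Phi> \<phi>)"
    and HL_maximal_OM: "\<Phi> \<in> nabla2_bar \<Longrightarrow> bounded_operator (HL_maximal :: ('a \<Rightarrow> ereal) \<Rightarrow> 'a \<Rightarrow> ereal)
      (OM_space \<Phi> \<phi>) (OM_norm \<Phi> \<phi>) (OM_space \<Phi> \<phi>) (OM_norm \<Phi> \<phi>)"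
    and HL_maximal_wOM: "\<Phi> \<in> nabla2_bar \<Longrightarrow> bounded_operator (HL_maximal :: ('a \<Rightarrow> ereal) \<Rightarrow> 'a \<Rightarrow> ereal)
      (wOM_space \<Phi> \<phi>) (wOM_norm \<Phi> \<phi>) (wOM_space \<Phi> \<phi>) (wOM_norm \<Phi> \<phi>)"
proof -
  have mono: "mono \<Phi>" and a: "a_of \<Phi> < \<infinity>" and zero: "\<Phi> 0 = 0"
    using \<Phi> unfolding Phi_bar_Y_def Phi_bar_def by auto
  have \<phi>: "\<And>r. r > 0 \<Longrightarrow> \<phi> r > 0" using \<phi>G unfolding G_dec_def by auto
  obtain A where q: "quasi_convex A \<Phi>" "A \<ge> 1" using Phi_bar_Y_quasi_convex[OF \<Phi>] by blast
  obtain K where K: "K > 0" "\<And>r s. 0 < r \<Longrightarrow> r / 2 < s \<Longrightarrow> \<phi> s \<le> K * \<phi> r"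
    using G_dec_doubling[OF \<phi>G] by blast
  have top: "\<Phi> top = top" by (rule quasi_convex_top[OF q a mono])
  show "bounded_operator (HL_maximal :: ('a \<Rightarrow> ereal) \<Rightarrow> 'a \<Rightarrow> ereal)
      (OM_space \<Phi> \<phi>) (OM_norm \<Phi> \<phi>) (wOM_space \<Phi> \<phi>) (wOM_norm \<Phi> \<phi>)"
  proof (rule bounded_operatorI)
    \<comment> \<open>\<open>K * A / A\<close> is \<open>K * D / c\<close> for c = D = A, left
      unreduced to match \<open>HL_maximal_weak_norm\<close>.\<close>
    let ?E = "max 1 (10 ^ DIM('a) * (K * A / A))"
    show "2 * A * A * ?E > 0" using q by simp
    fix f :: "'a \<Rightarrow> ereal" and \<mu> :: real
    assume "f \<in> OM_space \<Phi> \<phi>" and \<mu>: "\<mu> > 0" "OM_norm \<Phi> \<phi> f < ennreal \<mu>"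
    then have f [measurable]: "f \<in> borel_measurable lebesgue" unfolding OM_space_def by simp
    have "tail_bound \<Phi> \<phi> A A (\<lambda>x. eabs (f x) / ennreal \<mu>)"
    proof (rule tail_bound_strong[OF _ q top])
      show "(\<integral>\<^sup>+y\<in>ball a r. \<Phi> (eabs (f y) / ennreal \<mu>) \<partial>lebesgue) \<le> ennreal (\<phi> r) * emeasure lebesgue (ball a r)"
        if "r > 0" for a r
        by (rule OM_norm_lessD[OF \<mu>(2) mono that \<phi>[OF that]])
    qed measurable
    then show "wOM_norm \<Phi> \<phi> (HL_maximal f) \<le> ennreal (2 * A * A * ?E * \<mu>)"
      using q by (intro HL_maximal_weak_norm[OF f \<mu>(1) _ _ _ K(1) q \<phi> K(2)]) auto
  qed (auto simp: OM_space_def wOM_space_def HL_maximal_measurable)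
  assume "\<Phi> \<in> nabla2_bar"
  then obtain k where n: "nabla2_with k \<Phi>" unfolding nabla2_bar_def nabla2_with_def by auto
  then have k: "k > 1" unfolding nabla2_with_def by simp
  show "bounded_operator (HL_maximal :: ('a \<Rightarrow> ereal) \<Rightarrow> 'a \<Rightarrow> ereal)
      (OM_space \<Phi> \<phi>) (OM_norm \<Phi> \<phi>) (OM_space \<Phi> \<phi>) (OM_norm \<Phi> \<phi>)"
  proof (rule bounded_operatorI)
    let ?D = "max 1 ((10 ^ DIM('a) * (2 * k) + 1) * K)"
    \<comment> \<open>Two divisors with separate tasks: \<open>2 * A * k\<close> brings the maximal
      function down to a level of the layer sum, and \<open>A * ?D\<close> absorbs the resulting
      constant.\<close>
    have C: "2 * A * k > 0" "A * ?D > 0" using q k by auto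
    then show C0: "2 * A * k * (A * ?D) > 0" by (rule mult_pos_pos)
    fix f :: "'a \<Rightarrow> ereal" and \<mu> :: real
    assume "f \<in> OM_space \<Phi> \<phi>" and \<mu>: "\<mu> > 0" "OM_norm \<Phi> \<phi> f < ennreal \<mu>"
    then have f [measurable]: "f \<in> borel_measurable lebesgue" unfolding OM_space_def by simp
    show "OM_norm \<Phi> \<phi> (HL_maximal f) \<le> ennreal (2 * A * k * (A * ?D) * \<mu>)"
    proof (rule OM_norm_leI)
      show "2 * A * k * (A * ?D) * \<mu> > 0" using C0 \<mu>(1) by (rule mult_pos_pos)
      fix a :: 'a and r :: real assume r: "r > 0"
      show "(\<integral>\<^sup>+x\<in>ball a r. \<Phi> (eabs (HL_maximal f x) / ennreal (2 * A * k * (A * ?D) * \<mu>)) \<partial>lebesgue)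
        \<le> ennreal (\<phi> r) * emeasure lebesgue (ball a r)"
        unfolding eabs_HL_maximal_scale[OF f C0 \<mu>(1)] ennreal_divide_mult[OF C]
      proof (rule maxfun_strong_bound[OF _ n q a mono zero r K(1) \<phi> K(2)])
        show "(\<integral>\<^sup>+y\<in>ball a r. \<Phi> (eabs (f y) / ennreal \<mu>) \<partial>lebesgue) \<le> ennreal (\<phi> r) * emeasure lebesgue (ball a r)"
          if "r > 0" for a r
          by (rule OM_norm_lessD[OF \<mu>(2) mono that \<phi>[OF that]])
      qed auto
    qed (rule \<phi>)
  qed (auto simp: OM_space_def HL_maximal_measurable)
  show "bounded_operator (HL_maximal :: ('a \<Rightarrow> ereal) \<Rightarrow> 'a \<Rightarrow> ereal)
      (wOM_space \<Phi> \<phi>) (wOM_norm \<Phi> \<phi>) (wOM_space \<Phi> \<phi>) (wOM_norm \<Phi> \<phi>)"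
  proof (rule bounded_operatorI)
    \<comment> \<open>Here c = 1 and D = 2k, the pair produced by
      \<open>tail_bound_weak\<close>.\<close>
    let ?E = "max 1 (10 ^ DIM('a) * (K * (2 * k) / 1))"
    show "2 * 1 * A * ?E > 0" using q by simp
    fix f :: "'a \<Rightarrow> ereal" and \<mu> :: real
    assume "f \<in> wOM_space \<Phi> \<phi>" and \<mu>: "\<mu> > 0" "wOM_norm \<Phi> \<phi> f < ennreal \<mu>"
    then have f [measurable]: "f \<in> borel_measurable lebesgue" unfolding wOM_space_def by simp
    have "tail_bound \<Phi> \<phi> 1 (2 * k) (\<lambda>x. eabs (f x) / ennreal \<mu>)"
    proof (rule tail_bound_weak[OF _ n \<phi>])
      show "\<Phi> (ennreal t) * emeasure lebesgue {x \<in> ball a r. eabs (f x) / ennreal \<mu> > ennreal t}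
        \<le> ennreal (\<phi> r) * emeasure lebesgue (ball a r)" if "r > 0" "t > 0" for a r t
        by (rule wOM_norm_lessD[OF f \<mu>(2) that(1) \<phi>[OF that(1)] that(2)])
    qed measurable
    then show "wOM_norm \<Phi> \<phi> (HL_maximal f) \<le> ennreal (2 * 1 * A * ?E * \<mu>)"
      using k by (intro HL_maximal_weak_norm[OF f \<mu>(1) _ _ _ K(1) q \<phi> K(2)]) auto
  qed (auto simp: wOM_space_def HL_maximal_measurable)
qed

theorem theorem3p3:
  fixes \<Phi> :: "ennreal \<Rightarrow> ennreal" and \<phi> :: "real \<Rightarrow> real"
  assumes "\<Phi> \<in> Phi_bar_Y" and "\<phi> \<in> G_dec CARD('n::finite)"
  shows "bounded_operator (HL_maximal :: (real ^ 'n \<Rightarrow> ereal) \<Rightarrow> real ^ 'n \<Rightarrow> ereal)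
           (OM_space \<Phi> \<phi>) (OM_norm \<Phi> \<phi>) (wOM_space \<Phi> \<phi>) (wOM_norm \<Phi> \<phi>) \<and>
         (\<Phi> \<in> nabla2_bar \<longrightarrow>
           bounded_operator (HL_maximal :: (real ^ 'n \<Rightarrow> ereal) \<Rightarrow> real ^ 'n \<Rightarrow> ereal)
             (OM_space \<Phi> \<phi>) (OM_norm \<Phi> \<phi>) (OM_space \<Phi> \<phi>) (OM_norm \<Phi> \<phi>) \<and>
           bounded_operator (HL_maximal :: (real ^ 'n \<Rightarrow> ereal) \<Rightarrow> real ^ 'n \<Rightarrow> ereal)
             (wOM_space \<Phi> \<phi>) (wOM_norm \<Phi> \<phi>) (wOM_space \<Phi> \<phi>) (wOM_norm \<Phi> \<phi>))"
proof -
  have "\<phi> \<in> G_dec DIM(real ^ 'n)" using assms(2) by simp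
  from HL_maximal_bounded[OF assms(1) this] show ?thesis by blast
qed

end
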